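(* Bi-orderability is not a profinite property. That is, there exist finitely generated residually finite groups $G_1$ and $G_2$ with isomorphic profinite completions $\widehat{G_1}\cong\widehat{G_2}$ such that $G_1$ is bi-orderable and $G_2$ is not bi-orderable.
   Context: A group $G$ is bi-orderable if there exists a strict total ordering $<$ on $G$ such that for all $g,h,x,y\in G$, $x<y$ implies $gxh<gyh$. The profinite completion of a group $G$ is the inverse limit $\widehat{G}=\varprojlim G/N$, where $N$ ranges over all finite index normal subgroups of $G$ (ordered by reverse inclusion, with the natural projections $G/M\to G/N$ for $N\supset M$). A property $\mathcal{P}$ of finitely generated residually finite groups is a profinite property if for any two finitely generated residually finite groups $G_1,G_2$ with $\widehat{G_1}\cong\widehat{G_2}$, $G_1$ satisfies $\mathcal{P}$ if and only if $G_2$ satisfies $\mathcal{P}$. *)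

theory Defs
  imports
    "HOL-Analysis.Product_Topology"
    "HOL-Algebra.Product_Groups"
begin

definition bi_orderable :: "('a, 'b) monoid_scheme \<Rightarrow> bool"
  where "bi_orderable G \<longleftrightarrow>
    (\<exists>r \<subseteq> carrier G \<times> carrier G. strict_linear_order_on (carrier G) r \<and>
      (\<forall>g\<in>carrier G. \<forall>h\<in>carrier G. \<forall>x\<in>carrier G. \<forall>y\<in>carrier G.
        (x, y) \<in> r \<longrightarrow> (g \<otimes>\<^bsub>G\<^esub> x \<otimes>\<^bsub>G\<^esub> h, g \<otimes>\<^bsub>G\<^esub> y \<otimes>\<^bsub>G\<^esub> h) \<in> r))"

definition finitely_generated_group :: "('a, 'b) monoid_scheme \<Rightarrow> bool"
  where "finitely_generated_group G \<longleftrightarrow>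
    group G \<and> (\<exists>S \<subseteq> carrier G. finite S \<and> generate G S = carrier G)"

definition finite_index_normal :: "('a, 'b) monoid_scheme \<Rightarrow> 'a set set"
  where "finite_index_normal G = {N. N \<lhd> G \<and> finite (rcosets\<^bsub>G\<^esub> N)}"

definition residually_finite_group :: "('a, 'b) monoid_scheme \<Rightarrow> bool"
  where "residually_finite_group G \<longleftrightarrow>
    group G \<and> (\<forall>x\<in>carrier G. x \<noteq> \<one>\<^bsub>G\<^esub> \<longrightarrow> (\<exists>N\<in>finite_index_normal G. x \<notin> N))"

text \<open>
  The transition map from the quotient by \<open>M\<close> to the quotient by \<open>N \<supseteq> M\<close> sends a coset
  \<open>C\<close> of \<open>M\<close> to the coset \<open>NC\<close> of \<open>N\<close>; see lemma \<open>quotient_proj_r_coset\<close>.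
\<close>

definition quotient_proj :: "('a, 'b) monoid_scheme \<Rightarrow> 'a set \<Rightarrow> 'a set \<Rightarrow> 'a set"
  where "quotient_proj G N C = N <#>\<^bsub>G\<^esub> C"

lemma quotient_proj_r_coset:
  assumes "M \<lhd> G" "N \<lhd> G" "M \<subseteq> N" "x \<in> carrier G"
  shows "quotient_proj G N (M #>\<^bsub>G\<^esub> x) = N #>\<^bsub>G\<^esub> x"
proof -
  interpret M: normal M G by fact
  interpret N: normal N G by fact
  have "N <#>\<^bsub>G\<^esub> M = N"
  proof
    show "N <#>\<^bsub>G\<^esub> M \<subseteq> N"
      using assms(3) by (auto simp: set_mult_def)
    show "N \<subseteq> N <#>\<^bsub>G\<^esub> M"
    proof
      fix n assume n: "n \<in> N"
      have "n \<otimes>\<^bsub>G\<^esub> \<one>\<^bsub>G\<^esub> \<in> N <#>\<^bsub>G\<^esub> M"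
        unfolding set_mult_def by (intro UN_I[OF n] UN_I[OF subgroup.one_closed[OF M.subgroup_axioms]] singletonI)
      moreover have "n \<in> carrier G"
        using n N.subset by auto
      ultimately show "n \<in> N <#>\<^bsub>G\<^esub> M"
        by simp
    qed
  qed
  then show ?thesis
    unfolding quotient_proj_def
    using M.setmult_rcos_assoc[OF N.subset M.subset assms(4)] by simp
qed

text \<open>
  The inverse limit is realised as the set of coherent families inside the direct product of
  all finite quotients, with the componentwise operations; its topology is induced by the
  product of the discrete topologies.
\<close>

definition profinite_completion :: "('a, 'b) monoid_scheme \<Rightarrow> ('a set \<Rightarrow> 'a set) monoid"
  where "profinite_completion G =
    (product_group (finite_index_normal G) (\<lambda>N. G Mod N))
      \<lparr>carrier := {f \<in> \<Pi>\<^sub>E N\<in>finite_index_normal G. carrier (G Mod N).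
        \<forall>M\<in>finite_index_normal G. \<forall>N\<in>finite_index_normal G.
          M \<subseteq> N \<longrightarrow> quotient_proj G N (f M) = f N}\<rparr>"

definition profinite_completion_topology ::
    "('a, 'b) monoid_scheme \<Rightarrow> ('a set \<Rightarrow> 'a set) topology"
  where "profinite_completion_topology G =
    subtopology
      (product_topology (\<lambda>N. discrete_topology (carrier (G Mod N))) (finite_index_normal G))
      (carrier (profinite_completion G))"

lemma group_profinite_completion:
  fixes G :: "('a, 'b) monoid_scheme" (structure)
  assumes "group G"
  shows "group (profinite_completion G)"
proof -
  interpret group G by fact
  let ?I = "finite_index_normal G" and ?P = "product_group (finite_index_normal G) (\<lambda>N. G Mod N)"
  have nI: "N \<lhd> G" if "N \<in> ?I" for N
    using that by (simp add: finite_index_normal_def)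
  interpret P: group ?P
    by (rule product_group) (use nI normal.factorgroup_is_group in blast)
  have coh: "quotient_proj G N (f M) = f N"
    if "f \<in> carrier (profinite_completion G)" "M \<in> ?I" "N \<in> ?I" "M \<subseteq> N" for f M N
    using that by (simp add: profinite_completion_def)
  have "subgroup (carrier (profinite_completion G)) ?P"
  proof (rule P.subgroupI)
    have 1: "quotient_proj G N M = N" if "M \<in> ?I" "N \<in> ?I" "M \<subseteq> N" for M N
    proof -
      have "M \<subseteq> carrier G" "N \<subseteq> carrier G"
        using nI that normal_imp_subgroup subgroup.subset by blast+
      then show ?thesis
        using quotient_proj_r_coset[OF nI nI that(3) one_closed] that by simp
    qed
    show "carrier (profinite_completion G) \<subseteq> carrier ?P"
      by (auto simp: profinite_completion_def)
    have "\<one>\<^bsub>?P\<^esub> \<in> carrier (profinite_completion G)"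
      using P.one_closed by (auto simp: profinite_completion_def 1 FactGroup_def)
    then show "carrier (profinite_completion G) \<noteq> {}" by blast
  next
    fix f assume f: "f \<in> carrier (profinite_completion G)"
    then have fP: "f \<in> carrier ?P" by (simp add: profinite_completion_def)
    have inv: "(inv\<^bsub>?P\<^esub> f) N = set_inv (f N)" if "N \<in> ?I" for N
    proof -
      have "(inv\<^bsub>?P\<^esub> f) N = inv\<^bsub>G Mod N\<^esub> (f N)"
        using that fP by (subst inv_product_group) (auto simp: nI normal.factorgroup_is_group)
      moreover have "f N \<in> carrier (G Mod N)"
        using fP that by auto
      ultimately show ?thesis
        using normal.inv_FactGroup[OF nI[OF that]] by simp
    qed
    have "quotient_proj G N (set_inv (f M)) = set_inv (f N)"
      if MN: "M \<in> ?I" "N \<in> ?I" "M \<subseteq> N" for M N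
    proof -
      obtain x where x: "x \<in> carrier G" "f M = M #> x"
        using PiE_mem[OF fP[simplified] MN(1)] by (auto simp: carrier_FactGroup)
      have "f N = N #> x"
        using coh[OF f MN] MN x quotient_proj_r_coset[OF nI nI MN(3) x(1)] by simp
      then show ?thesis
        using x MN by (simp add: normal.rcos_inv[OF nI] quotient_proj_r_coset[OF nI nI MN(3)])
    qed
    then show "inv\<^bsub>?P\<^esub> f \<in> carrier (profinite_completion G)"
      using P.inv_closed[OF fP] by (simp add: profinite_completion_def inv)
  next
    fix f g
    assume f: "f \<in> carrier (profinite_completion G)" and g: "g \<in> carrier (profinite_completion G)"
    then have fP: "f \<in> carrier ?P" and gP: "g \<in> carrier ?P"
      by (simp_all add: profinite_completion_def)
    have "quotient_proj G N (f M <#> g M) = f N <#> g N"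
      if MN: "M \<in> ?I" "N \<in> ?I" "M \<subseteq> N" for M N
    proof -
      obtain x y where x: "x \<in> carrier G" "f M = M #> x" and y: "y \<in> carrier G" "g M = M #> y"
        using PiE_mem[OF fP[simplified] MN(1)] PiE_mem[OF gP[simplified] MN(1)]
        by (auto simp: carrier_FactGroup)
      have "f N = N #> x" "g N = N #> y"
        using coh[OF f MN] coh[OF g MN] MN x y quotient_proj_r_coset[OF nI nI MN(3)] by simp_all
      then show ?thesis
        using x y MN by (simp add: normal.rcos_sum[OF nI] quotient_proj_r_coset[OF nI nI MN(3)])
    qed
    then show "f \<otimes>\<^bsub>?P\<^esub> g \<in> carrier (profinite_completion G)"
      using P.m_closed[OF fP gP] by (simp add: profinite_completion_def FactGroup_def)
  qed
  then show ?thesis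
    using P.subgroup_imp_group by (simp add: profinite_completion_def)
qed

text \<open>Isomorphism of profinite completions means isomorphism of topological groups.\<close>

definition isomorphic_profinite_completions ::
    "('a, 'b) monoid_scheme \<Rightarrow> ('c, 'd) monoid_scheme \<Rightarrow> bool"
  where "isomorphic_profinite_completions G H \<longleftrightarrow>
    (\<exists>\<phi> \<in> iso (profinite_completion G) (profinite_completion H).
      homeomorphic_map (profinite_completion_topology G) (profinite_completion_topology H) \<phi>)"

text \<open>
  The type variable bounds the universe of the groups considered. Every finitely generated
  group is countable, so the instance \<open>'a = nat\<close> covers all of them up to isomorphism.
\<close>

definition profinite_property :: "('a monoid \<Rightarrow> bool) \<Rightarrow> bool"
  where "profinite_property P \<longleftrightarrow>
    (\<forall>G\<^sub>1 G\<^sub>2.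
      finitely_generated_group G\<^sub>1 \<and> residually_finite_group G\<^sub>1 \<and>
      finitely_generated_group G\<^sub>2 \<and> residually_finite_group G\<^sub>2 \<and>
      isomorphic_profinite_completions G\<^sub>1 G\<^sub>2 \<longrightarrow> (P G\<^sub>1 \<longleftrightarrow> P G\<^sub>2))"

end

theory Submission
  imports
    Defs
    "HOL-Computational_Algebra.Polynomial"
    "HOL-Number_Theory.Residues"
begin

text \<open>
  Let \<open>N\<close> be a finitely generated, residually finite, bi-orderable group with an involution \<open>\<theta>\<close>
  that maps some \<open>v \<noteq> 1\<close> to its inverse. The two groups are \<open>N \<times> \<int>\<close> and the semidirect product
  \<open>N \<rtimes> \<int>\<close> in which the generator of \<open>\<int>\<close> acts as \<open>\<theta>\<close>. Both inherit finite generation and residual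
  finiteness (\<open>finitely_generated_E\<close>, \<open>residually_finite_E\<close>). The first is bi-orderable, compare the
  integers first (\<open>bi_orderable_direct_extension\<close>); the second is not, since there \<open>v\<close> is
  conjugate to its inverse (\<open>not_bi_orderable_if_conj_inv\<close>).

  The completions agree as soon as \<open>\<theta>\<close> becomes inner in the profinite completion of \<open>N\<close>: if
  elements \<open>c\<^sub>n\<close> of \<open>N\<close> converge to \<open>c\<close> there and conjugation by \<open>c\<close> extends \<open>\<theta>\<close>, then multiplying the
  generator of \<open>\<int>\<close> by \<open>c\<close> turns one completion into the other. Before the limit this is
  the family of bijections \<open>(x, i) \<mapsto> (x c\<^sub>n\<^sup>i, i)\<close>, which are homomorphisms modulo any given finite
  index normal subgroup once \<open>n\<close> is large. Such families in both directions, inverse to each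
  other, give an isomorphism of completions (\<open>isomorphic_profinite_completions_if_limit_homs\<close>).

  For \<open>N\<close>, let \<open>M\<close> be the finitely supported functions from \<open>\<int>\<close> to the rationals with denominator
  prime to \<open>3\<close>, and take the group of affine maps of \<open>M\<close> generated by the translation \<open>v\<close> by the indicator of \<open>0\<close>, the
  multiplication \<open>a\<close> by \<open>i \<mapsto> (3i + 1)\<^sup>2\<close>, the multiplication \<open>b\<close> by the constant \<open>2\<close>, and the shift \<open>t\<close>.
  The involution is \<open>-1\<close> on \<open>M\<close> and trivial on \<open>a\<close>, \<open>b\<close>, \<open>t\<close>.

  \<^item> Order: all multipliers are positive rational functions of \<open>i\<close>, so they are ordered by their
    germs at infinity and preserve the sign of the last nonzero value of an element of \<open>M\<close>.

  \<^item> Residual finiteness: reduce both \<open>i\<close> and the values modulo \<open>3\<^sup>n\<close>.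

  \<^item> The limit: the conjugates of \<open>a\<close> by powers of \<open>t\<close> make \<open>v\<close> conjugate to its \<open>d\<^sup>2\<close>-th power for
    every \<open>d\<close> prime to \<open>3\<close>, so in each finite quotient the order of \<open>v\<close> is a power of \<open>3\<close>. Conjugation
    by the \<open>3\<^sup>k\<close>-th power of \<open>b\<close> raises \<open>v\<close> to the power \<open>2\<^sup>e\<close>, \<open>e = 3\<^sup>k\<close>, and \<open>2\<^sup>e \<equiv> -1\<close> modulo \<open>3\<^sup>k\<^sup>+\<^sup>1\<close>.
    Hence \<open>c\<^sub>n\<close>, the power of \<open>b\<close> with exponent \<open>3\<close> to the \<open>n!\<close>, eventually inverts \<open>v\<close>; the factorial
    makes the sequence converge (\<open>conjugator_converges\<close>, \<open>conjugator_negates\<close>).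
\<close>

section \<open>Bi-orders and positive cones\<close>

lemma (in group) mult_inv_cancel:
  assumes "x \<in> carrier G" "y \<in> carrier G"
  shows "x \<otimes> (inv x \<otimes> y) = y" "inv x \<otimes> (x \<otimes> y) = y"
  using assms by (simp_all flip: m_assoc)

definition positive_cone :: "('a, 'b) monoid_scheme \<Rightarrow> 'a set \<Rightarrow> bool"
  where "positive_cone G P \<longleftrightarrow> P \<subseteq> carrier G \<and> \<one>\<^bsub>G\<^esub> \<notin> P \<and>
    (\<forall>x\<in>P. \<forall>y\<in>P. x \<otimes>\<^bsub>G\<^esub> y \<in> P) \<and>
    (\<forall>g\<in>carrier G. \<forall>x\<in>P. g \<otimes>\<^bsub>G\<^esub> x \<otimes>\<^bsub>G\<^esub> inv\<^bsub>G\<^esub> g \<in> P) \<and>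
    (\<forall>x\<in>carrier G. x = \<one>\<^bsub>G\<^esub> \<or> x \<in> P \<or> inv\<^bsub>G\<^esub> x \<in> P)"

lemma bi_orderable_if_positive_cone:
  fixes G (structure)
  assumes "group G" "positive_cone G P"
  shows "bi_orderable G"
proof -
  interpret group G by fact
  let ?r = "{(x, y). x \<in> carrier G \<and> y \<in> carrier G \<and> y \<otimes> inv x \<in> P}"
  have P: "P \<subseteq> carrier G" "\<one> \<notin> P" "\<And>x y. x \<in> P \<Longrightarrow> y \<in> P \<Longrightarrow> x \<otimes> y \<in> P"
    "\<And>g x. g \<in> carrier G \<Longrightarrow> x \<in> P \<Longrightarrow> g \<otimes> x \<otimes> inv g \<in> P"
    "\<And>x. x \<in> carrier G \<Longrightarrow> x = \<one> \<or> x \<in> P \<or> inv x \<in> P"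
    using assms(2) unfolding positive_cone_def by blast+
  have "trans ?r"
  proof (rule transI)
    fix x y z assume xy: "(x, y) \<in> ?r" and yz: "(y, z) \<in> ?r"
    then have "(z \<otimes> inv y) \<otimes> (y \<otimes> inv x) \<in> P" using P(3) by blast
    moreover have "(z \<otimes> inv y) \<otimes> (y \<otimes> inv x) = z \<otimes> inv x"
      using xy yz by (simp add: m_assoc mult_inv_cancel)
    ultimately show "(x, z) \<in> ?r" using xy yz by auto
  qed
  moreover have "irrefl ?r" using P(2) by (auto simp: irrefl_def)
  moreover have "total_on (carrier G) ?r"
  proof (rule total_onI)
    fix x y assume xy: "x \<in> carrier G" "y \<in> carrier G" "x \<noteq> y"
    have "inv (y \<otimes> inv x) = x \<otimes> inv y" using xy by (simp add: inv_mult_group)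
    moreover have "y \<otimes> inv x \<noteq> \<one>" using xy inv_equality inv_inv by (metis inv_closed)
    ultimately show "(x, y) \<in> ?r \<or> (y, x) \<in> ?r" using P(5)[of "y \<otimes> inv x"] xy by auto
  qed
  moreover have "(g \<otimes> x \<otimes> h, g \<otimes> y \<otimes> h) \<in> ?r"
    if "g \<in> carrier G" "h \<in> carrier G" "(x, y) \<in> ?r" for g h x y
  proof -
    have "(g \<otimes> y \<otimes> h) \<otimes> inv (g \<otimes> x \<otimes> h) = g \<otimes> (y \<otimes> inv x) \<otimes> inv g"
      using that by (simp add: inv_mult_group m_assoc mult_inv_cancel)
    then show ?thesis using that P(4)[of g "y \<otimes> inv x"] by simp
  qed
  ultimately show ?thesis
    unfolding bi_orderable_def strict_linear_order_on_def
    by (intro exI[of _ ?r]) blast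
qed

text \<open>
  The lexicographic order on an extension of a group by the integers: the integer coordinate is
  compared first, and a conjugation invariant cone decides on its kernel.
\<close>

lemma positive_cone_extension:
  fixes G (structure) and h :: "'a \<Rightarrow> int"
  assumes "group G"
    and hom: "\<And>x y. x \<in> carrier G \<Longrightarrow> y \<in> carrier G \<Longrightarrow> h (x \<otimes> y) = h x + h y"
    and PN: "\<And>x. x \<in> PN \<Longrightarrow> x \<in> carrier G \<and> h x = 0 \<and> x \<noteq> \<one>"
      "\<And>x y. x \<in> PN \<Longrightarrow> y \<in> PN \<Longrightarrow> x \<otimes> y \<in> PN"
      "\<And>g x. g \<in> carrier G \<Longrightarrow> x \<in> PN \<Longrightarrow> g \<otimes> x \<otimes> inv g \<in> PN"
      "\<And>x. x \<in> carrier G \<Longrightarrow> h x = 0 \<Longrightarrow> x = \<one> \<or> x \<in> PN \<or> inv x \<in> PN"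
  shows "positive_cone G ({x \<in> carrier G. 0 < h x} \<union> PN)"
proof -
  interpret group G by fact
  have h1: "h \<one> = 0" using hom[of \<one> \<one>] by simp
  have hinv: "h (inv x) = - h x" if "x \<in> carrier G" for x
    using hom[of x "inv x"] that h1 by simp
  show ?thesis
    unfolding positive_cone_def
  proof (intro conjI ballI)
    fix x assume x: "x \<in> carrier G"
    show "x = \<one> \<or> x \<in> {x \<in> carrier G. 0 < h x} \<union> PN \<or> inv x \<in> {x \<in> carrier G. 0 < h x} \<union> PN"
      using PN(4)[OF x] hinv[OF x] x by (cases "h x" "0::int" rule: linorder_cases) auto
  qed (use PN(1-3) h1 hinv in \<open>auto simp: hom\<close>)
qed

lemma positive_cone_subgroup:
  assumes "group G" "subgroup H G" "positive_cone G P"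
  shows "positive_cone (G\<lparr>carrier := H\<rparr>) (P \<inter> H)"
proof -
  interpret group G by fact
  interpret H: subgroup H G by fact
  show ?thesis
    using assms(3) by (auto simp: positive_cone_def m_inv_consistent[OF assms(2)])
qed

lemma bi_orderable_iso:
  fixes G (structure) and H (structure)
  assumes "group G" "h \<in> iso G H" "bi_orderable G"
  shows "bi_orderable H"
proof -
  interpret group G by fact
  obtain r where r: "r \<subseteq> carrier G \<times> carrier G" "strict_linear_order_on (carrier G) r"
    "\<And>g k x y. \<lbrakk>g \<in> carrier G; k \<in> carrier G; x \<in> carrier G; y \<in> carrier G; (x, y) \<in> r\<rbrakk> \<Longrightarrow>
      (g \<otimes>\<^bsub>G\<^esub> x \<otimes>\<^bsub>G\<^esub> k, g \<otimes>\<^bsub>G\<^esub> y \<otimes>\<^bsub>G\<^esub> k) \<in> r"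
    using assms(3) unfolding bi_orderable_def by auto
  have inj: "inj_on h (carrier G)" and im: "carrier H = h ` carrier G"
    and hm: "\<And>x y. x \<in> carrier G \<Longrightarrow> y \<in> carrier G \<Longrightarrow> h (x \<otimes>\<^bsub>G\<^esub> y) = h x \<otimes>\<^bsub>H\<^esub> h y"
    using assms(2) by (auto simp: iso_def hom_def bij_betw_def)
  define r' where "r' = map_prod h h ` r"
  have mem: "(h x, h y) \<in> r' \<longleftrightarrow> (x, y) \<in> r" if "x \<in> carrier G" "y \<in> carrier G" for x y
  proof
    assume "(h x, h y) \<in> r'"
    then obtain a b where ab: "(a, b) \<in> r" "h x = h a" "h y = h b" by (auto simp: r'_def)
    then have "x = a" "y = b" using that r(1) inj by (auto dest: inj_onD)
    then show "(x, y) \<in> r" using ab by simp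
  qed (force simp: r'_def)
  have sub: "r' \<subseteq> carrier H \<times> carrier H" using r(1) im by (auto simp: r'_def)
  have "trans r'"
  proof (rule transI)
    fix x y z assume xy: "(x, y) \<in> r'" and yz: "(y, z) \<in> r'"
    then obtain x0 y0 z0 where e: "x = h x0" "y = h y0" "z = h z0"
      and c: "x0 \<in> carrier G" "y0 \<in> carrier G" "z0 \<in> carrier G"
      using sub im by blast
    have "trans r" using r(2) by (simp add: strict_linear_order_on_def)
    then have "(x0, z0) \<in> r" using xy yz mem c e by (metis transD)
    then show "(x, z) \<in> r'" using mem c e by simp
  qed
  moreover have "irrefl r'"
  proof (rule irreflI)
    fix x show "(x, x) \<notin> r'"
    proof
      assume x: "(x, x) \<in> r'"
      then obtain x0 where "x = h x0" "x0 \<in> carrier G" using sub im by blast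
      then show False using x mem r(2) by (simp add: strict_linear_order_on_def irrefl_def)
    qed
  qed
  moreover have "total_on (carrier H) r'"
  proof (rule total_onI)
    fix x y assume xy: "x \<in> carrier H" "y \<in> carrier H" "x \<noteq> y"
    then obtain x0 y0 where "x = h x0" "x0 \<in> carrier G" "y = h y0" "y0 \<in> carrier G" using im by blast
    then show "(x, y) \<in> r' \<or> (y, x) \<in> r'"
      using xy mem r(2) by (auto simp: strict_linear_order_on_def total_on_def)
  qed
  moreover have "(g \<otimes>\<^bsub>H\<^esub> x \<otimes>\<^bsub>H\<^esub> k, g \<otimes>\<^bsub>H\<^esub> y \<otimes>\<^bsub>H\<^esub> k) \<in> r'"
    if hyp: "g \<in> carrier H" "k \<in> carrier H" "x \<in> carrier H" "y \<in> carrier H" "(x, y) \<in> r'" for g k x y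
  proof -
    obtain g0 k0 x0 y0 where e: "g = h g0" "k = h k0" "x = h x0" "y = h y0"
      and c: "g0 \<in> carrier G" "k0 \<in> carrier G" "x0 \<in> carrier G" "y0 \<in> carrier G"
      using hyp(1-4) im by auto
    have r0: "(x0, y0) \<in> r" using hyp(5) mem c e by simp
    have "(g0 \<otimes>\<^bsub>G\<^esub> x0 \<otimes>\<^bsub>G\<^esub> k0, g0 \<otimes>\<^bsub>G\<^esub> y0 \<otimes>\<^bsub>G\<^esub> k0) \<in> r" using r(3) c r0 by blast
    then have "(h (g0 \<otimes>\<^bsub>G\<^esub> x0 \<otimes>\<^bsub>G\<^esub> k0), h (g0 \<otimes>\<^bsub>G\<^esub> y0 \<otimes>\<^bsub>G\<^esub> k0)) \<in> r'"
      using mem c by simp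
    then show ?thesis using c by (simp add: hm e)
  qed
  ultimately show ?thesis
    unfolding bi_orderable_def strict_linear_order_on_def using sub by blast
qed

text \<open>
  Conjugation by \<open>g\<close> preserves the side of \<open>\<one>\<close> on which \<open>x\<close> lies, whereas inversion reverses it.
\<close>

lemma not_bi_orderable_if_conj_inv:
  fixes G (structure)
  assumes "group G" "x \<in> carrier G" "g \<in> carrier G" "x \<noteq> \<one>" "g \<otimes> x \<otimes> inv g = inv x"
  shows "\<not> bi_orderable G"
proof
  interpret group G by fact
  assume "bi_orderable G"
  then obtain r where r: "strict_linear_order_on (carrier G) r"
    "\<And>g k x y. \<lbrakk>g \<in> carrier G; k \<in> carrier G; x \<in> carrier G; y \<in> carrier G; (x, y) \<in> r\<rbrakk> \<Longrightarrow>
      (g \<otimes> x \<otimes> k, g \<otimes> y \<otimes> k) \<in> r"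
    unfolding bi_orderable_def by auto
  have step: "(inv x, \<one>) \<in> r" if "(x, \<one>) \<in> r"
    using r(2)[of g "inv g" x \<one>] that assms by simp
  have step': "(\<one>, inv x) \<in> r" if "(\<one>, x) \<in> r"
    using r(2)[of g "inv g" \<one> x] that assms by simp
  have rev: "(\<one>, x) \<in> r" if "(inv x, \<one>) \<in> r"
    using r(2)[of x \<one> "inv x" \<one>] that assms by simp
  have rev': "(x, \<one>) \<in> r" if "(\<one>, inv x) \<in> r"
    using r(2)[of x \<one> \<one> "inv x"] that assms by simp
  have "(x, \<one>) \<in> r \<or> (\<one>, x) \<in> r" "trans r" "irrefl r"
    using r(1) assms unfolding strict_linear_order_on_def total_on_def by auto
  then show False
    using step step' rev rev' by (meson irrefl_def transD)
qed

section \<open>Normal subgroups of finite index\<close>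

lemma (in group) rcos_eq_iff:
  assumes "subgroup K G" "x \<in> carrier G" "y \<in> carrier G"
  shows "K #> x = K #> y \<longleftrightarrow> x \<otimes> inv y \<in> K"
  using assms subgroup.rcos_module[OF assms(1) group_axioms, of y x] rcos_self[OF _ assms(1)]
    repr_independence[of x K y] by auto

lemma (in group) rcos_eq_self_iff:
  assumes "subgroup K G" "x \<in> carrier G"
  shows "K #> x = K \<longleftrightarrow> x \<in> K"
  using assms coset_join1 coset_join2 subgroup.subset by metis

lemma finite_index_normalI:
  fixes G (structure)
  assumes "N \<lhd> G" "finite (f ` carrier G)"
    and f: "\<And>x y. x \<in> carrier G \<Longrightarrow> y \<in> carrier G \<Longrightarrow> f x = f y \<Longrightarrow> x \<otimes> inv y \<in> N"
  shows "N \<in> finite_index_normal G"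
proof -
  interpret normal N G by fact
  have "rcosets N \<subseteq> (\<lambda>z. N #> inv_into (carrier G) f z) ` f ` carrier G"
  proof
    fix C assume "C \<in> rcosets N"
    then obtain x where x: "x \<in> carrier G" "C = N #> x" by (auto simp: RCOSETS_def)
    define y where "y = inv_into (carrier G) f (f x)"
    have y: "y \<in> carrier G" "f x = f y" using x(1) by (auto simp: y_def inv_into_into f_inv_into_f)
    have "x \<in> N #> y" using f[OF x(1) y] y(1) x(1) by (simp add: rcos_module)
    then have "C = N #> y" using repr_independence[OF _ y(1)] x(2) subgroup_axioms by simp
    then show "C \<in> (\<lambda>z. N #> inv_into (carrier G) f z) ` f ` carrier G"
      using x(1) by (auto simp: y_def)
  qed
  then have "finite (rcosets N)" using assms(2) finite_surj finite_imageI by (metis finite_subset)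
  then show ?thesis using assms(1) by (simp add: finite_index_normal_def)
qed

lemma finite_index_normal_kernel:
  fixes G (structure) and H (structure)
  assumes "group G" "group H" "h \<in> hom G H" "finite (h ` carrier G)"
  shows "kernel G H h \<in> finite_index_normal G"
proof -
  interpret h: group_hom G H h
    using assms by (simp add: group_hom_def group_hom_axioms_def)
  show ?thesis
    by (rule finite_index_normalI[OF h.normal_kernel assms(4)]) (auto simp: kernel_def)
qed

lemma finite_index_normal_vimage:
  fixes G (structure) and H (structure)
  assumes "group G" "group H" "h \<in> hom G H" "K \<in> finite_index_normal H"
  shows "{x \<in> carrier G. h x \<in> K} \<in> finite_index_normal G"
proof -
  interpret h: group_hom G H h
    using assms by (simp add: group_hom_def group_hom_axioms_def)
  interpret K: normal K H using assms(4) by (simp add: finite_index_normal_def)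
  let ?h = "\<lambda>x. K #>\<^bsub>H\<^esub> h x"
  have "?h \<in> hom G (H Mod K)"
    using hom_compose[OF assms(3) K.r_coset_hom_Mod] by (simp add: comp_def)
  moreover have "finite (?h ` carrier G)"
  proof (rule finite_subset)
    show "?h ` carrier G \<subseteq> rcosets\<^bsub>H\<^esub> K" by (auto simp: RCOSETS_def intro: h.hom_closed)
    show "finite (rcosets\<^bsub>H\<^esub> K)" using assms(4) by (simp add: finite_index_normal_def)
  qed
  moreover have "kernel G (H Mod K) ?h = {x \<in> carrier G. h x \<in> K}"
    unfolding kernel_def
  proof (rule Collect_cong, rule conj_cong[OF refl])
    fix x assume "x \<in> carrier G"
    then show "K #>\<^bsub>H\<^esub> h x = \<one>\<^bsub>H Mod K\<^esub> \<longleftrightarrow> h x \<in> K"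
      using h.H.rcos_eq_self_iff[OF K.subgroup_axioms h.hom_closed] by simp
  qed
  ultimately show ?thesis
    using finite_index_normal_kernel[OF assms(1) K.factorgroup_is_group, of ?h] by simp
qed

lemma finite_index_normal_Int:
  assumes "group G" "K \<in> finite_index_normal G" "L \<in> finite_index_normal G"
  shows "K \<inter> L \<in> finite_index_normal G"
proof -
  interpret group G by fact
  interpret K: normal K G using assms(2) by (simp add: finite_index_normal_def)
  interpret L: normal L G using assms(3) by (simp add: finite_index_normal_def)
  show ?thesis
  proof (rule finite_index_normalI[where f = "\<lambda>x. (K #>\<^bsub>G\<^esub> x, L #>\<^bsub>G\<^esub> x)"])
    show "(K \<inter> L) \<lhd> G" using normal_subgroup_intersect K.normal_axioms L.normal_axioms by blast
    have "finite ((rcosets\<^bsub>G\<^esub> K) \<times> (rcosets\<^bsub>G\<^esub> L))"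
      using assms(2,3) by (simp add: finite_index_normal_def)
    then show "finite ((\<lambda>x. (K #>\<^bsub>G\<^esub> x, L #>\<^bsub>G\<^esub> x)) ` carrier G)"
      by (rule rev_finite_subset) (auto simp: RCOSETS_def)
    fix x y assume xy: "x \<in> carrier G" "y \<in> carrier G" "(K #>\<^bsub>G\<^esub> x, L #>\<^bsub>G\<^esub> x) = (K #>\<^bsub>G\<^esub> y, L #>\<^bsub>G\<^esub> y)"
    then show "x \<otimes>\<^bsub>G\<^esub> inv\<^bsub>G\<^esub> y \<in> K \<inter> L"
      using rcos_eq_iff[OF K.subgroup_axioms] rcos_eq_iff[OF L.subgroup_axioms] by auto
  qed
qed

lemma residually_finite_group_inj_hom:
  fixes G (structure) and H (structure)
  assumes "group G" "residually_finite_group H" "h \<in> hom G H" "inj_on h (carrier G)"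
  shows "residually_finite_group G"
  unfolding residually_finite_group_def
proof (intro conjI ballI impI)
  have "group H" using assms(2) by (simp add: residually_finite_group_def)
  then interpret h: group_hom G H h
    using assms by (simp add: group_hom_def group_hom_axioms_def)
  fix x assume x: "x \<in> carrier G" "x \<noteq> \<one>\<^bsub>G\<^esub>"
  then have "h x \<noteq> \<one>\<^bsub>H\<^esub>" using assms(4) h.hom_one by (metis h.G.one_closed inj_onD)
  then obtain K where "K \<in> finite_index_normal H" "h x \<notin> K"
    using assms(2) h.hom_closed[OF x(1)] unfolding residually_finite_group_def by blast
  then show "\<exists>N\<in>finite_index_normal G. x \<notin> N"
    by (intro bexI[OF _ finite_index_normal_vimage[OF assms(1) \<open>group H\<close> assms(3)]]) auto
qed fact

text \<open>
  The kernel of an action on a finite set: an element modulo the kernel is determined by the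
  function that it induces on the set.
\<close>

lemma finite_index_normal_right_action:
  fixes G (structure)
  assumes "group G" "finite X"
    and "\<And>g x. g \<in> carrier G \<Longrightarrow> x \<in> X \<Longrightarrow> act x g \<in> X"
    and "\<And>g h x. g \<in> carrier G \<Longrightarrow> h \<in> carrier G \<Longrightarrow> x \<in> X \<Longrightarrow> act x (g \<otimes> h) = act (act x g) h"
    and "\<And>x. x \<in> X \<Longrightarrow> act x \<one> = x"
  shows "{g \<in> carrier G. \<forall>x\<in>X. act x g = x} \<in> finite_index_normal G" (is "?K \<in> _")
proof -
  interpret group G by fact
  have act_inv: "act (act x g) (inv g) = x" if "x \<in> X" "g \<in> carrier G" for x g
    using that assms(4)[of g "inv g" x] assms(5) by simp
  have "subgroup ?K G"
  proof
    show "inv g \<in> ?K" if "g \<in> ?K" for g using that act_inv[of _ g] by auto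
  qed (auto simp: assms)
  then have "?K \<lhd> G"
  proof (rule normal_invI)
    fix g k assume g: "g \<in> carrier G" and k: "k \<in> ?K"
    have "act x (g \<otimes> k \<otimes> inv g) = x" if x: "x \<in> X" for x
    proof -
      have "act x (g \<otimes> k \<otimes> inv g) = act (act (act x g) k) (inv g)"
        using x g k assms(3,4) by simp
      also have "act (act x g) k = act x g" using k assms(3)[OF g x] by blast
      finally show ?thesis using act_inv[OF x g] by simp
    qed
    then show "g \<otimes> k \<otimes> inv g \<in> ?K" using g k by simp
  qed
  then show ?thesis
  proof (rule finite_index_normalI)
    let ?f = "\<lambda>g. \<lambda>x\<in>X. act x g"
    have "?f ` carrier G \<subseteq> X \<rightarrow>\<^sub>E X" using assms(3) by auto
    then show "finite (?f ` carrier G)"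
      using finite_PiE[OF assms(2), of "\<lambda>_. X"] assms(2) finite_subset by blast
    fix g h assume gh: "g \<in> carrier G" "h \<in> carrier G" "?f g = ?f h"
    have "act x (g \<otimes> inv h) = x" if "x \<in> X" for x
    proof -
      have "act x g = act x h" using gh(3) that by (metis restrict_apply')
      then show ?thesis using that gh assms(4)[of g "inv h" x] act_inv[of x h] by simp
    qed
    then show "g \<otimes> inv h \<in> ?K" using gh by simp
  qed
qed

lemma finitely_generated_group_iso:
  assumes "finitely_generated_group G" "group H" "h \<in> iso G H"
  shows "finitely_generated_group H"
proof -
  obtain S where S: "S \<subseteq> carrier G" "finite S" "generate G S = carrier G" and "group G"
    using assms(1) by (auto simp: finitely_generated_group_def)
  then interpret h: group_hom G H h
    using assms by (simp add: group_hom_def group_hom_axioms_def iso_def)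
  have "generate H (h ` S) = carrier H"
    using h.generate_img[OF S(1)] S(3) assms(3) by (simp add: iso_def bij_betw_def)
  moreover have "h ` S \<subseteq> carrier H" using S(1) by auto
  ultimately show ?thesis
    using S(2) assms(2) unfolding finitely_generated_group_def by blast
qed

section \<open>Homomorphisms in the limit and profinite completions\<close>

text \<open>
  A sequence of maps that induces a continuous homomorphism of profinite completions: modulo each
  finite index normal subgroup of the target it is eventually constant, uniformly on the source, and
  eventually multiplicative. No single map needs to be a homomorphism.
\<close>

definition limit_hom :: "('a, 'c) monoid_scheme \<Rightarrow> ('b, 'd) monoid_scheme \<Rightarrow> (nat \<Rightarrow> 'a \<Rightarrow> 'b) \<Rightarrow> bool"
  where "limit_hom G H T \<longleftrightarrow>
    (\<forall>n. \<forall>x\<in>carrier G. T n x \<in> carrier H) \<and>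
    (\<forall>K\<in>finite_index_normal H. \<exists>m. \<forall>n\<ge>m.
      (\<forall>x\<in>carrier G. K #>\<^bsub>H\<^esub> T n x = K #>\<^bsub>H\<^esub> T m x) \<and>
      (\<forall>x\<in>carrier G. \<forall>y\<in>carrier G. K #>\<^bsub>H\<^esub> T n (x \<otimes>\<^bsub>G\<^esub> y) = K #>\<^bsub>H\<^esub> (T n x \<otimes>\<^bsub>H\<^esub> T n y)))"

definition limit_coset ::
    "('a, 'c) monoid_scheme \<Rightarrow> ('b, 'd) monoid_scheme \<Rightarrow> (nat \<Rightarrow> 'a \<Rightarrow> 'b) \<Rightarrow> 'b set \<Rightarrow> 'a \<Rightarrow> 'b set"
  where "limit_coset G H T K x = (THE C. \<exists>m. \<forall>n\<ge>m. K #>\<^bsub>H\<^esub> T n x = C)"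

definition limit_kernel ::
    "('a, 'c) monoid_scheme \<Rightarrow> ('b, 'd) monoid_scheme \<Rightarrow> (nat \<Rightarrow> 'a \<Rightarrow> 'b) \<Rightarrow> 'b set \<Rightarrow> 'a set"
  where "limit_kernel G H T K = {x \<in> carrier G. limit_coset G H T K x = K}"

text \<open>
  The value at \<open>K\<close> depends only on the coordinate of \<open>f\<close> at the limit kernel of \<open>K\<close>, which is a coset
  on which \<open>limit_coset\<close> is constant; the union extracts this constant.
\<close>

definition completed_hom ::
    "('a, 'c) monoid_scheme \<Rightarrow> ('b, 'd) monoid_scheme \<Rightarrow> (nat \<Rightarrow> 'a \<Rightarrow> 'b) \<Rightarrow>
      ('a set \<Rightarrow> 'a set) \<Rightarrow> ('b set \<Rightarrow> 'b set)"
  where "completed_hom G H T f =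
    (\<lambda>K\<in>finite_index_normal H. \<Union> (limit_coset G H T K ` f (limit_kernel G H T K)))"

lemma limit_coset_eventually:
  assumes "limit_hom G H T" "K \<in> finite_index_normal H"
  obtains m where "\<And>n x. n \<ge> m \<Longrightarrow> x \<in> carrier G \<Longrightarrow> limit_coset G H T K x = K #>\<^bsub>H\<^esub> T n x"
    "\<And>n x y. n \<ge> m \<Longrightarrow> x \<in> carrier G \<Longrightarrow> y \<in> carrier G \<Longrightarrow>
      K #>\<^bsub>H\<^esub> T n (x \<otimes>\<^bsub>G\<^esub> y) = K #>\<^bsub>H\<^esub> (T n x \<otimes>\<^bsub>H\<^esub> T n y)"
proof -
  obtain m where m: "\<And>n x. n \<ge> m \<Longrightarrow> x \<in> carrier G \<Longrightarrow> K #>\<^bsub>H\<^esub> T n x = K #>\<^bsub>H\<^esub> T m x"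
    "\<And>n x y. n \<ge> m \<Longrightarrow> x \<in> carrier G \<Longrightarrow> y \<in> carrier G \<Longrightarrow>
      K #>\<^bsub>H\<^esub> T n (x \<otimes>\<^bsub>G\<^esub> y) = K #>\<^bsub>H\<^esub> (T n x \<otimes>\<^bsub>H\<^esub> T n y)"
    using assms unfolding limit_hom_def by meson
  have "limit_coset G H T K x = K #>\<^bsub>H\<^esub> T n x" if n: "n \<ge> m" and x: "x \<in> carrier G" for n x
    unfolding limit_coset_def
  proof (rule the_equality)
    show "\<exists>k. \<forall>j\<ge>k. K #>\<^bsub>H\<^esub> T j x = K #>\<^bsub>H\<^esub> T n x"
      using m(1)[OF _ x] n by metis
    fix C assume "\<exists>k. \<forall>j\<ge>k. K #>\<^bsub>H\<^esub> T j x = C"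
    then obtain k where "\<And>j. j \<ge> k \<Longrightarrow> K #>\<^bsub>H\<^esub> T j x = C" by blast
    from this[of "max k m"] show "C = K #>\<^bsub>H\<^esub> T n x"
      using m(1)[OF _ x, of "max k m"] m(1)[OF n x] by simp
  qed
  then show thesis using m(2) that by blast
qed

lemma topspace_profinite_completion_topology:
  "topspace (profinite_completion_topology F) = carrier (profinite_completion F)"
  by (auto simp: profinite_completion_topology_def profinite_completion_def)

lemma profinite_completion_coset_nonempty:
  assumes "group G" "f \<in> carrier (profinite_completion G)" "K \<in> finite_index_normal G"
  obtains x where "x \<in> f K"
proof -
  have "f K \<in> carrier (G Mod K)" using assms by (auto simp: profinite_completion_def)
  then obtain z where z: "z \<in> carrier G" "f K = K #>\<^bsub>G\<^esub> z"
    by (auto simp: carrier_FactGroup)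
  then have "z \<in> f K"
    using group.rcos_self[OF assms(1)] assms(3) by (simp add: finite_index_normal_def normal_imp_subgroup)
  then show thesis by (rule that)
qed

lemma mult_profinite_completion:
  "(f \<otimes>\<^bsub>profinite_completion G\<^esub> g) =
    (\<lambda>K\<in>finite_index_normal G. f K <#>\<^bsub>G\<^esub> g K)"
  by (simp add: profinite_completion_def)

context
  fixes G :: "('a, 'c) monoid_scheme" and H :: "('b, 'd) monoid_scheme" and T :: "nat \<Rightarrow> 'a \<Rightarrow> 'b"
  assumes G: "group G" and H: "group H" and T: "limit_hom G H T"
begin

interpretation G: group G by (rule G)
interpretation H: group H by (rule H)

abbreviation (input) "lcos \<equiv> limit_coset G H T"
abbreviation (input) "lker \<equiv> limit_kernel G H T"

lemma T_closed: "x \<in> carrier G \<Longrightarrow> T n x \<in> carrier H"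
  using T by (simp add: limit_hom_def)

lemma limit_coset_hom:
  assumes K: "K \<in> finite_index_normal H"
  shows "lcos K \<in> hom G (H Mod K)"
proof -
  interpret K: normal K H using K by (simp add: finite_index_normal_def)
  obtain m where m: "\<And>n x. n \<ge> m \<Longrightarrow> x \<in> carrier G \<Longrightarrow> lcos K x = K #>\<^bsub>H\<^esub> T n x"
    "\<And>n x y. n \<ge> m \<Longrightarrow> x \<in> carrier G \<Longrightarrow> y \<in> carrier G \<Longrightarrow>
      K #>\<^bsub>H\<^esub> T n (x \<otimes>\<^bsub>G\<^esub> y) = K #>\<^bsub>H\<^esub> (T n x \<otimes>\<^bsub>H\<^esub> T n y)"
    using limit_coset_eventually[OF T K] by blast
  show ?thesis
    using m(1)[OF order.refl] m(2)[OF order.refl] T_closed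
    by (auto simp: hom_def carrier_FactGroup K.rcos_sum)
qed

lemma limit_kernel_eq_kernel: "lker K = kernel G (H Mod K) (lcos K)"
  by (simp add: limit_kernel_def kernel_def)

lemma limit_kernel_finite_index_normal:
  assumes K: "K \<in> finite_index_normal H"
  shows "lker K \<in> finite_index_normal G"
  unfolding limit_kernel_eq_kernel
proof (rule finite_index_normal_kernel[OF G])
  show "group (H Mod K)" using K by (simp add: finite_index_normal_def normal.factorgroup_is_group)
  show hom: "lcos K \<in> hom G (H Mod K)" by (rule limit_coset_hom[OF K])
  have "lcos K ` carrier G \<subseteq> rcosets\<^bsub>H\<^esub> K" using hom by (auto simp: hom_def FactGroup_def)
  then show "finite (lcos K ` carrier G)"
    using K finite_subset by (auto simp: finite_index_normal_def)
qed

lemma limit_coset_eq_iff: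
  assumes K: "K \<in> finite_index_normal H" and x: "x \<in> carrier G" and y: "y \<in> lker K #>\<^bsub>G\<^esub> x"
  shows "y \<in> carrier G" "lcos K y = lcos K x"
proof -
  interpret K: normal K H using K by (simp add: finite_index_normal_def)
  interpret Q: group "H Mod K" by (rule K.factorgroup_is_group)
  obtain k where k: "k \<in> lker K" "y = k \<otimes>\<^bsub>G\<^esub> x" using y by (auto simp: r_coset_def)
  then have kG: "k \<in> carrier G" "lcos K k = \<one>\<^bsub>H Mod K\<^esub>" by (auto simp: limit_kernel_def)
  show "y \<in> carrier G" using k kG x by simp
  have "lcos K y = lcos K k \<otimes>\<^bsub>H Mod K\<^esub> lcos K x"
    using limit_coset_hom[OF K] k(2) kG x by (simp add: hom_mult)
  then show "lcos K y = lcos K x"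
    using kG limit_coset_hom[OF K] x hom_in_carrier by (metis Q.l_one)
qed

lemma limit_coset_mono:
  assumes K: "K \<in> finite_index_normal H" and L: "L \<in> finite_index_normal H" and KL: "K \<subseteq> L"
    and x: "x \<in> carrier G"
  shows "quotient_proj H L (lcos K x) = lcos L x"
proof -
  obtain m where m: "\<And>n x. n \<ge> m \<Longrightarrow> x \<in> carrier G \<Longrightarrow> lcos K x = K #>\<^bsub>H\<^esub> T n x"
    using limit_coset_eventually[OF T K] by metis
  obtain k where k: "\<And>n x. n \<ge> k \<Longrightarrow> x \<in> carrier G \<Longrightarrow> lcos L x = L #>\<^bsub>H\<^esub> T n x"
    using limit_coset_eventually[OF T L] by metis
  show ?thesis
    using m[of "max m k" x] k[of "max m k" x] x T_closed[OF x] K L KL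
    by (simp add: quotient_proj_r_coset finite_index_normal_def)
qed

lemma limit_kernel_mono:
  assumes "K \<in> finite_index_normal H" "L \<in> finite_index_normal H" "K \<subseteq> L"
  shows "lker K \<subseteq> lker L"
proof
  fix x assume x: "x \<in> lker K"
  have "quotient_proj H L K = L"
  proof -
    have "K \<subseteq> carrier H" "L \<subseteq> carrier H"
      using assms by (auto simp: finite_index_normal_def dest: normal_imp_subgroup subgroup.subset)
    then show ?thesis
      using quotient_proj_r_coset[of K H L "\<one>\<^bsub>H\<^esub>"] assms by (simp add: finite_index_normal_def)
  qed
  then show "x \<in> lker L"
    using x limit_coset_mono[OF assms, of x] by (simp add: limit_kernel_def)
qed

lemma completed_hom_eval:
  assumes f: "f \<in> carrier (profinite_completion G)" and K: "K \<in> finite_index_normal H"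
    and x: "x \<in> f (lker K)"
  shows "x \<in> carrier G" "f (lker K) = lker K #>\<^bsub>G\<^esub> x" "completed_hom G H T f K = lcos K x"
proof -
  have N: "lker K \<in> finite_index_normal G" by (rule limit_kernel_finite_index_normal[OF K])
  interpret N: normal "lker K" G using N by (simp add: finite_index_normal_def)
  have "f (lker K) \<in> carrier (G Mod lker K)" using f N by (auto simp: profinite_completion_def)
  then obtain z where z: "z \<in> carrier G" "f (lker K) = lker K #>\<^bsub>G\<^esub> z"
    by (auto simp: carrier_FactGroup)
  show xG: "x \<in> carrier G" using x z limit_coset_eq_iff(1)[OF K] by blast
  show fx: "f (lker K) = lker K #>\<^bsub>G\<^esub> x"
    using x z G.repr_independence N.subgroup_axioms by simp
  have "lcos K y = lcos K x" if "y \<in> f (lker K)" for y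
    using limit_coset_eq_iff(2)[OF K xG] that unfolding fx .
  then have "lcos K ` f (lker K) = {lcos K x}"
    using x unfolding set_eq_iff image_iff by blast
  then show "completed_hom G H T f K = lcos K x" using K by (simp add: completed_hom_def)
qed

lemma completed_hom_closed:
  assumes f: "f \<in> carrier (profinite_completion G)"
  shows "completed_hom G H T f \<in> carrier (profinite_completion H)"
proof -
  have val: "\<exists>x. x \<in> f (lker K) \<and> x \<in> carrier G \<and> f (lker K) = lker K #>\<^bsub>G\<^esub> x \<and>
      completed_hom G H T f K = lcos K x"
    if K: "K \<in> finite_index_normal H" for K
    using profinite_completion_coset_nonempty[OF G f limit_kernel_finite_index_normal[OF K]]
      completed_hom_eval[OF f K] by metis
  have "completed_hom G H T f K \<in> carrier (H Mod K)" if K: "K \<in> finite_index_normal H" for K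
    using val[OF K] limit_coset_hom[OF K] by (auto simp: hom_def)
  moreover have "quotient_proj H L (completed_hom G H T f K) = completed_hom G H T f L"
    if K: "K \<in> finite_index_normal H" and L: "L \<in> finite_index_normal H" and KL: "K \<subseteq> L" for K L
  proof -
    obtain x where x: "x \<in> f (lker K)" "x \<in> carrier G" "completed_hom G H T f K = lcos K x"
      using val[OF K] by blast
    have lK: "lker K \<in> finite_index_normal G" "lker L \<in> finite_index_normal G"
      using K L limit_kernel_finite_index_normal by auto
    have "quotient_proj G (lker L) (f (lker K)) = f (lker L)"
      using f lK limit_kernel_mono[OF K L KL] by (simp add: profinite_completion_def)
    moreover have "\<one>\<^bsub>G\<^esub> \<in> lker L"
      using lK(2) by (simp add: finite_index_normal_def normal_imp_subgroup subgroup.one_closed)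
    ultimately have "\<one>\<^bsub>G\<^esub> \<otimes>\<^bsub>G\<^esub> x \<in> f (lker L)"
      using x(1) unfolding quotient_proj_def set_mult_def by blast
    then have "completed_hom G H T f L = lcos L x"
      using completed_hom_eval(3)[OF f L] x(2) by simp
    then show ?thesis using limit_coset_mono[OF K L KL x(2)] x(3) by simp
  qed
  ultimately show ?thesis
    by (auto simp: profinite_completion_def completed_hom_def)
qed

lemma completed_hom_hom:
  "completed_hom G H T \<in> hom (profinite_completion G) (profinite_completion H)"
proof (rule homI)
  fix f g
  assume f: "f \<in> carrier (profinite_completion G)" and g: "g \<in> carrier (profinite_completion G)"
  let ?c = "completed_hom G H T"
  interpret PG: group "profinite_completion G" by (rule group_profinite_completion[OF G])
  have fg: "f \<otimes>\<^bsub>profinite_completion G\<^esub> g \<in> carrier (profinite_completion G)"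
    using f g by simp
  show "?c (f \<otimes>\<^bsub>profinite_completion G\<^esub> g) = ?c f \<otimes>\<^bsub>profinite_completion H\<^esub> ?c g"
  proof (rule ext)
    fix K
    show "?c (f \<otimes>\<^bsub>profinite_completion G\<^esub> g) K = (?c f \<otimes>\<^bsub>profinite_completion H\<^esub> ?c g) K"
    proof (cases "K \<in> finite_index_normal H")
      case K: True
      have N: "lker K \<in> finite_index_normal G" by (rule limit_kernel_finite_index_normal[OF K])
      obtain x where x: "x \<in> f (lker K)" using profinite_completion_coset_nonempty[OF G f N] by blast
      obtain y where y: "y \<in> g (lker K)" using profinite_completion_coset_nonempty[OF G g N] by blast
      note ex = completed_hom_eval[OF f K x] and ey = completed_hom_eval[OF g K y]
      have "(f \<otimes>\<^bsub>profinite_completion G\<^esub> g) (lker K) = f (lker K) <#>\<^bsub>G\<^esub> g (lker K)"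
        using N by (simp add: mult_profinite_completion)
      then have "x \<otimes>\<^bsub>G\<^esub> y \<in> (f \<otimes>\<^bsub>profinite_completion G\<^esub> g) (lker K)"
        using x y unfolding set_mult_def by blast
      then have "?c (f \<otimes>\<^bsub>profinite_completion G\<^esub> g) K = lcos K (x \<otimes>\<^bsub>G\<^esub> y)"
        by (rule completed_hom_eval(3)[OF fg K])
      also have "\<dots> = lcos K x <#>\<^bsub>H\<^esub> lcos K y"
        using hom_mult[OF limit_coset_hom[OF K] ex(1) ey(1)] by simp
      finally show ?thesis
        using K ex(3) ey(3) by (simp add: mult_profinite_completion)
    qed (simp add: completed_hom_def mult_profinite_completion)
  qed
qed (rule completed_hom_closed)

text \<open>
  Each coordinate of the image is a function of a single coordinate of the argument.
\<close>

lemma continuous_map_completed_hom: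
  "continuous_map (profinite_completion_topology G) (profinite_completion_topology H)
    (completed_hom G H T)"
proof -
  let ?D = "\<lambda>N. discrete_topology (carrier (G Mod N))"
  have "continuous_map (profinite_completion_topology G) (discrete_topology (carrier (H Mod K)))
      (\<lambda>f. completed_hom G H T f K)" if K: "K \<in> finite_index_normal H" for K
  proof -
    let ?e = "\<lambda>C. \<Union> (lcos K ` C)"
    have N: "lker K \<in> finite_index_normal G" by (rule limit_kernel_finite_index_normal[OF K])
    have e: "?e \<in> carrier (G Mod lker K) \<rightarrow> carrier (H Mod K)"
    proof
      fix C assume "C \<in> carrier (G Mod lker K)"
      then obtain x where x: "x \<in> carrier G" "C = lker K #>\<^bsub>G\<^esub> x" by (auto simp: carrier_FactGroup)
      moreover have "x \<in> C"
        using x N G.rcos_self by (simp add: finite_index_normal_def normal_imp_subgroup)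
      moreover have "lcos K y = lcos K x" if "y \<in> C" for y
        using limit_coset_eq_iff(2)[OF K x(1)] that unfolding x(2) .
      ultimately have "lcos K ` C = {lcos K x}"
        unfolding set_eq_iff image_iff by blast
      then show "?e C \<in> carrier (H Mod K)" using x(1) limit_coset_hom[OF K] by (auto simp: hom_def)
    qed
    have "continuous_map (profinite_completion_topology G) (?D (lker K)) (\<lambda>f. f (lker K))"
      unfolding profinite_completion_topology_def
      by (rule continuous_map_from_subtopology[OF continuous_map_product_projection[OF N]])
    moreover have "continuous_map (?D (lker K)) (discrete_topology (carrier (H Mod K))) ?e"
      using e by (simp add: continuous_map_from_discrete_topology)
    ultimately have "continuous_map (profinite_completion_topology G)
        (discrete_topology (carrier (H Mod K))) (?e \<circ> (\<lambda>f. f (lker K)))"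
      by (rule continuous_map_compose)
    then show ?thesis using K by (simp add: comp_def completed_hom_def)
  qed
  moreover have "completed_hom G H T ` topspace (profinite_completion_topology G)
      \<subseteq> extensional (finite_index_normal H)"
    by (auto simp: completed_hom_def)
  ultimately show ?thesis
    unfolding profinite_completion_topology_def[of H]
    by (intro continuous_map_into_subtopology)
      (auto simp: continuous_map_componentwise topspace_profinite_completion_topology completed_hom_closed)
qed

end

text \<open>
  If \<open>S n\<close> is a left inverse of \<open>T n\<close> for every \<open>n\<close>, pulling \<open>K\<close> back along \<open>S\<close> and then along \<open>T\<close> returns
  \<open>K\<close>; uniformity of the convergence allows the same index \<open>n\<close> to be used in both steps.
\<close>

lemma completed_hom_inverse:
  assumes G: "group G" and H: "group H" and T: "limit_hom G H T" and S: "limit_hom H G S"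
    and ST: "\<And>n x. x \<in> carrier G \<Longrightarrow> S n (T n x) = x"
    and f: "f \<in> carrier (profinite_completion G)"
  shows "completed_hom H G S (completed_hom G H T f) = f"
proof (rule ext)
  fix K
  show "completed_hom H G S (completed_hom G H T f) K = f K"
  proof (cases "K \<in> finite_index_normal G")
    case K: True
    interpret G: group G by fact
    interpret H: group H by fact
    have sK: "subgroup K G" using K by (simp add: finite_index_normal_def normal_imp_subgroup)
    define L where "L = limit_kernel H G S K"
    have L: "L \<in> finite_index_normal H"
      unfolding L_def by (rule limit_kernel_finite_index_normal[OF H G S K])
    have sL: "subgroup L H" using L by (simp add: finite_index_normal_def normal_imp_subgroup)
    obtain m where m: "\<And>n x. n \<ge> m \<Longrightarrow> x \<in> carrier H \<Longrightarrow> limit_coset H G S K x = K #>\<^bsub>G\<^esub> S n x"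
      using limit_coset_eventually[OF S K] by metis
    obtain k where k: "\<And>n x. n \<ge> k \<Longrightarrow> x \<in> carrier G \<Longrightarrow> limit_coset G H T L x = L #>\<^bsub>H\<^esub> T n x"
      using limit_coset_eventually[OF T L] by metis
    define n where "n = max m k"
    have Tc: "T n x \<in> carrier H" if "x \<in> carrier G" for x using T that by (simp add: limit_hom_def)
    have Slim: "limit_coset H G S K y = K #>\<^bsub>G\<^esub> S n y" if "y \<in> carrier H" for y
      using m that by (simp add: n_def)
    have Tlim: "limit_coset G H T L x = L #>\<^bsub>H\<^esub> T n x" if "x \<in> carrier G" for x
      using k that by (simp add: n_def)
    have "limit_kernel G H T L = K"
    proof (rule Set.set_eqI)
      fix x
      have "x \<in> limit_kernel G H T L \<longleftrightarrow> x \<in> carrier G \<and> T n x \<in> L"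
        unfolding limit_kernel_def
        by (cases "x \<in> carrier G") (simp_all add: Tlim H.rcos_eq_self_iff[OF sL Tc])
      also have "\<dots> \<longleftrightarrow> x \<in> carrier G \<and> K #>\<^bsub>G\<^esub> x = K"
        unfolding L_def limit_kernel_def by (cases "x \<in> carrier G") (simp_all add: Slim Tc ST)
      also have "\<dots> \<longleftrightarrow> x \<in> K"
        by (cases "x \<in> carrier G")
          (use G.rcos_eq_self_iff[OF sK] subgroup.subset[OF sK] in \<open>simp_all, blast\<close>)
      finally show "x \<in> limit_kernel G H T L \<longleftrightarrow> x \<in> K" .
    qed
    moreover obtain x where x: "x \<in> f (limit_kernel G H T L)"
      using profinite_completion_coset_nonempty[OF G f limit_kernel_finite_index_normal[OF G H T L]] .
    ultimately have xG: "x \<in> carrier G" and fK: "f K = K #>\<^bsub>G\<^esub> x"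
      and cT: "completed_hom G H T f L = L #>\<^bsub>H\<^esub> T n x"
      using completed_hom_eval[OF G H T f L x] Tlim by auto
    have "T n x \<in> completed_hom G H T f L"
      using cT H.rcos_self[OF Tc[OF xG] sL] by simp
    then have "completed_hom H G S (completed_hom G H T f) K = limit_coset H G S K (T n x)"
      using completed_hom_eval(3)[OF H G S completed_hom_closed[OF G H T f] K] by (simp add: L_def)
    then show ?thesis using Slim[OF Tc[OF xG]] ST[OF xG] fK by simp
  next
    case False
    then show ?thesis using f
      by (auto simp: completed_hom_def profinite_completion_def PiE_def extensional_def)
  qed
qed

theorem isomorphic_profinite_completions_if_limit_homs:
  assumes G: "group G" and H: "group H" and T: "limit_hom G H T" and S: "limit_hom H G S"
    and ST: "\<And>n x. x \<in> carrier G \<Longrightarrow> S n (T n x) = x"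
    and TS: "\<And>n y. y \<in> carrier H \<Longrightarrow> T n (S n y) = y"
  shows "isomorphic_profinite_completions G H"
proof -
  let ?\<phi> = "completed_hom G H T" and ?\<psi> = "completed_hom H G S"
  have inv: "?\<psi> (?\<phi> f) = f" if "f \<in> carrier (profinite_completion G)" for f
    by (rule completed_hom_inverse[OF G H T S ST that])
  have inv': "?\<phi> (?\<psi> f) = f" if "f \<in> carrier (profinite_completion H)" for f
    by (rule completed_hom_inverse[OF H G S T TS that])
  have "bij_betw ?\<phi> (carrier (profinite_completion G)) (carrier (profinite_completion H))"
    by (rule bij_betw_byWitness[where f' = ?\<psi>])
      (use inv inv' completed_hom_closed[OF G H T] completed_hom_closed[OF H G S] in auto)
  then have "?\<phi> \<in> iso (profinite_completion G) (profinite_completion H)"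
    using completed_hom_hom[OF G H T] by (simp add: iso_def)
  moreover have "homeomorphic_maps (profinite_completion_topology G) (profinite_completion_topology H) ?\<phi> ?\<psi>"
    unfolding homeomorphic_maps_def
    using continuous_map_completed_hom[OF G H T] continuous_map_completed_hom[OF H G S] inv inv'
    by (simp add: topspace_profinite_completion_topology)
  ultimately show ?thesis
    unfolding isomorphic_profinite_completions_def using homeomorphic_maps_imp_map by blast
qed

lemma limit_hom_const:
  assumes "h \<in> hom G H"
  shows "limit_hom G H (\<lambda>_. h)"
  using assms by (auto simp: limit_hom_def hom_def)

lemma isomorphic_profinite_completions_if_iso:
  assumes "group G" "group H" "h \<in> iso G H"
  shows "isomorphic_profinite_completions G H"
proof (rule isomorphic_profinite_completions_if_limit_homs[OF assms(1,2)])
  let ?k = "inv_into (carrier G) h"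
  have "h \<in> hom G H" "?k \<in> hom H G"
    using assms(3) group.iso_set_sym[OF assms(1,3)] by (auto simp: iso_def)
  then show "limit_hom G H (\<lambda>_. h)" "limit_hom H G (\<lambda>_. ?k)"
    using limit_hom_const by blast+
qed (use assms(3) in \<open>auto simp: iso_def bij_betw_def f_inv_into_f\<close>)

lemma isomorphic_profinite_completions_trans:
  assumes "isomorphic_profinite_completions G H" "isomorphic_profinite_completions H K"
  shows "isomorphic_profinite_completions G K"
  using assms iso_set_trans homeomorphic_map_compose
  unfolding isomorphic_profinite_completions_def by blast

section \<open>Extensions of the integers by an involution\<close>

text \<open>
  The \<open>i\<close>-th power of an involution, for an integer \<open>i\<close>.
\<close>

definition parity_pow :: "('a \<Rightarrow> 'a) \<Rightarrow> int \<Rightarrow> 'a \<Rightarrow> 'a"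
  where "parity_pow \<theta> i x = (if even i then x else \<theta> x)"

definition involution_extension :: "('a, 'b) monoid_scheme \<Rightarrow> ('a \<Rightarrow> 'a) \<Rightarrow> ('a \<times> int) monoid"
  where "involution_extension G \<theta> =
    \<lparr>carrier = carrier G \<times> UNIV,
     monoid.mult = (\<lambda>(x, i) (y, j). (x \<otimes>\<^bsub>G\<^esub> parity_pow \<theta> i y, i + j)),
     one = (\<one>\<^bsub>G\<^esub>, 0)\<rparr>"

locale involutive_group = group G for G (structure) +
  fixes \<theta> :: "'a \<Rightarrow> 'a"
  assumes \<theta>_hom: "\<theta> \<in> hom G G" and \<theta>_\<theta>: "x \<in> carrier G \<Longrightarrow> \<theta> (\<theta> x) = x"
begin

abbreviation E where "E \<equiv> involution_extension G \<theta>"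

lemma carrier_E: "carrier E = carrier G \<times> UNIV"
  and mult_E: "(x, i) \<otimes>\<^bsub>E\<^esub> (y, j) = (x \<otimes> parity_pow \<theta> i y, i + j)"
  and one_E: "\<one>\<^bsub>E\<^esub> = (\<one>, 0)"
  by (simp_all add: involution_extension_def)

lemma \<theta>_closed: "x \<in> carrier G \<Longrightarrow> \<theta> x \<in> carrier G"
  and \<theta>_mult: "x \<in> carrier G \<Longrightarrow> y \<in> carrier G \<Longrightarrow> \<theta> (x \<otimes> y) = \<theta> x \<otimes> \<theta> y"
  using \<theta>_hom by (auto simp: hom_def)

lemma \<theta>_one: "\<theta> \<one> = \<one>"
  using hom_one[OF \<theta>_hom is_group is_group] .

lemma parity_pow_simps [simp]:
  "x \<in> carrier G \<Longrightarrow> parity_pow \<theta> i x \<in> carrier G"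
  "x \<in> carrier G \<Longrightarrow> y \<in> carrier G \<Longrightarrow>
    parity_pow \<theta> i (x \<otimes> y) = parity_pow \<theta> i x \<otimes> parity_pow \<theta> i y"
  "parity_pow \<theta> i \<one> = \<one>"
  "x \<in> carrier G \<Longrightarrow> parity_pow \<theta> i (parity_pow \<theta> j x) = parity_pow \<theta> (i + j) x"
  "parity_pow \<theta> 0 x = x"
  "parity_pow \<theta> (- i) x = parity_pow \<theta> i x"
  by (auto simp: parity_pow_def \<theta>_closed \<theta>_mult \<theta>_one \<theta>_\<theta>)

lemma group_E: "group E"
proof (rule groupI)
  show "x \<otimes>\<^bsub>E\<^esub> y \<otimes>\<^bsub>E\<^esub> z = x \<otimes>\<^bsub>E\<^esub> (y \<otimes>\<^bsub>E\<^esub> z)"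
    if "x \<in> carrier E" "y \<in> carrier E" "z \<in> carrier E" for x y z
    using that by (cases x; cases y; cases z) (auto simp: carrier_E mult_E m_assoc)
  show "\<exists>y\<in>carrier E. y \<otimes>\<^bsub>E\<^esub> x = \<one>\<^bsub>E\<^esub>" if "x \<in> carrier E" for x
  proof (cases x)
    case (Pair a i)
    then have a: "a \<in> carrier G" using that by (simp add: carrier_E)
    have "(parity_pow \<theta> i (inv a), - i) \<otimes>\<^bsub>E\<^esub> x = \<one>\<^bsub>E\<^esub>"
      using a Pair by (simp add: mult_E one_E flip: parity_pow_simps(2))
    then show ?thesis using a by (intro bexI) (auto simp: carrier_E)
  qed
qed (auto simp: carrier_E mult_E one_E)

lemma embed_hom: "(\<lambda>x. (x, 0)) \<in> hom G E"
  by (simp add: hom_def carrier_E mult_E)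

lemma inv_E:
  assumes "x \<in> carrier G"
  shows "inv\<^bsub>E\<^esub> (x, i) = (parity_pow \<theta> i (inv x), - i)"
proof -
  interpret E: group E by (rule group_E)
  show ?thesis
    using assms by (intro E.inv_equality)
      (simp_all add: carrier_E mult_E one_E flip: parity_pow_simps(2))
qed

lemma int_pow_E: "(\<one>, 1) [^]\<^bsub>E\<^esub> (i::int) = (\<one>, i)"
proof -
  interpret E: group E by (rule group_E)
  have *: "(\<one>, 1) [^]\<^bsub>E\<^esub> (n::nat) = (\<one>, int n)" for n
  proof (induction n)
    case 0
    show ?case unfolding E.nat_pow_0 one_E by simp
  next
    case (Suc n)
    show ?case unfolding E.nat_pow_Suc Suc.IH mult_E by simp
  qed
  show ?thesis
  proof (cases "0 \<le> i")
    case True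
    then show ?thesis using *[of "nat i"] unfolding int_pow_def2 by simp
  next
    case False
    then show ?thesis using *[of "nat (- i)"] inv_E[OF one_closed, of "- i"] unfolding int_pow_def2 by simp
  qed
qed

lemma finitely_generated_E:
  assumes "finitely_generated_group G"
  shows "finitely_generated_group E"
proof -
  interpret E: group E by (rule group_E)
  interpret h: group_hom G E "\<lambda>x. (x, 0)"
    using embed_hom by (simp add: group_hom_def group_hom_axioms_def)
  obtain S where S: "S \<subseteq> carrier G" "finite S" "generate G S = carrier G"
    using assms by (auto simp: finitely_generated_group_def)
  let ?S = "insert (\<one>, 1) ((\<lambda>x. (x, 0)) ` S)"
  have sub: "?S \<subseteq> carrier E" using S(1) by (auto simp: carrier_E)
  have "(x, i) \<in> generate E ?S" if x: "x \<in> carrier G" for x i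
  proof -
    have "(x, 0) \<in> (\<lambda>x. (x, 0)) ` generate G S" using S(3) x by blast
    then have "(x, 0) \<in> generate E ((\<lambda>x. (x, 0)) ` S)" using h.generate_img[OF S(1)] by simp
    then have 1: "(x, 0) \<in> generate E ?S"
      using E.mono_generate[of "(\<lambda>x. (x, 0)) ` S" ?S] by blast
    have "(\<one>, 1) [^]\<^bsub>E\<^esub> i \<in> generate E ?S"
      by (rule group.subgroup_int_pow_closed[OF group_E E.generate_is_subgroup[OF sub]])
        (simp add: generate.incl)
    then have "(x, 0) \<otimes>\<^bsub>E\<^esub> (\<one>, i) \<in> generate E ?S"
      unfolding int_pow_E by (rule generate.eng[OF 1])
    then show ?thesis using x by (simp add: mult_E)
  qed
  then have "generate E ?S = carrier E"
    using E.generate_incl[OF sub] by (auto simp: carrier_E)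
  then show ?thesis
    using S(2) sub group_E unfolding finitely_generated_group_def by (intro conjI exI[of _ ?S]) auto
qed

text \<open>
  An even integer acts trivially, so a \<open>\<theta>\<close>-invariant normal subgroup of \<open>G\<close> together with a subgroup of
  even integers is normal.
\<close>

lemma finite_index_normal_E:
  assumes L: "L \<in> finite_index_normal G" and inv: "\<And>x. x \<in> L \<Longrightarrow> \<theta> x \<in> L" and c: "0 < c"
  shows "{(x, i). x \<in> L \<and> 2 * c dvd i} \<in> finite_index_normal E" (is "?K \<in> _")
proof -
  interpret E: group E by (rule group_E)
  interpret L: normal L G using L by (simp add: finite_index_normal_def)
  have even: "parity_pow \<theta> i x = x" if "2 * c dvd i" for i x
    using that by (auto simp: parity_pow_def)
  have par: "parity_pow \<theta> i x \<in> L" if "x \<in> L" for i x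
    using that inv by (simp add: parity_pow_def)
  have "subgroup ?K E"
  proof
    show "inv\<^bsub>E\<^esub> x \<in> ?K" if "x \<in> ?K" for x
      using that by (cases x) (auto simp: inv_E even L.m_inv_closed)
  qed (auto simp: carrier_E mult_E one_E even)
  then have "?K \<lhd> E"
  proof (rule E.normal_invI)
    fix g k assume g: "g \<in> carrier E" and k: "k \<in> ?K"
    obtain x i where gi: "g = (x, i)" "x \<in> carrier G" using g by (cases g) (auto simp: carrier_E)
    obtain y j where kj: "k = (y, j)" "y \<in> L" "2 * c dvd j" using k by auto
    then have "even j" by auto
    then have "g \<otimes>\<^bsub>E\<^esub> k \<otimes>\<^bsub>E\<^esub> inv\<^bsub>E\<^esub> g = (x \<otimes> parity_pow \<theta> i y \<otimes> inv x, j)"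
      using gi kj by (simp add: inv_E mult_E) (simp add: parity_pow_def)
    moreover have "x \<otimes> parity_pow \<theta> i y \<otimes> inv x \<in> L"
      using L.inv_op_closed2[OF gi(2) par[OF kj(2)]] .
    ultimately show "g \<otimes>\<^bsub>E\<^esub> k \<otimes>\<^bsub>E\<^esub> inv\<^bsub>E\<^esub> g \<in> ?K" using kj(3) by simp
  qed
  then show ?thesis
  proof (rule finite_index_normalI)
    let ?f = "\<lambda>(x, i). (L #> x, i mod (2 * c))"
    have "?f ` carrier E \<subseteq> (rcosets L) \<times> {0..<2 * c}"
      using c by (auto simp: carrier_E RCOSETS_def)
    then show "finite (?f ` carrier E)"
      using L finite_subset by (auto simp: finite_index_normal_def)
    fix g h assume gh: "g \<in> carrier E" "h \<in> carrier E" "?f g = ?f h"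
    obtain x i y j where e: "g = (x, i)" "h = (y, j)" "x \<in> carrier G" "y \<in> carrier G"
      using gh by (cases g; cases h) (auto simp: carrier_E)
    then have "L #> x = L #> y" and ij: "2 * c dvd i - j"
      using gh(3) by (auto simp: mod_eq_dvd_iff)
    then have "x \<otimes> inv y \<in> L" using rcos_eq_iff[OF L.subgroup_axioms] e by simp
    moreover have "parity_pow \<theta> i (parity_pow \<theta> j (inv y)) = inv y"
    proof -
      have "2 dvd i - j" using ij dvd_mult_left by blast
      then show ?thesis using e by simp (simp add: parity_pow_def)
    qed
    ultimately show "g \<otimes>\<^bsub>E\<^esub> inv\<^bsub>E\<^esub> h \<in> ?K"
      using e ij by (simp add: inv_E mult_E del: parity_pow_simps(4))
  qed
qed

lemma residually_finite_E:
  assumes "residually_finite_group G"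
  shows "residually_finite_group E"
  unfolding residually_finite_group_def
proof (intro conjI ballI impI group_E)
  fix g assume g: "g \<in> carrier E" "g \<noteq> \<one>\<^bsub>E\<^esub>"
  then obtain x i where gi: "g = (x, i)" "x \<in> carrier G" by (cases g) (auto simp: carrier_E)
  show "\<exists>N\<in>finite_index_normal E. g \<notin> N"
  proof (cases "x = \<one>")
    case True
    then have "i \<noteq> 0" using g gi by (simp add: one_E)
    then have "\<not> 2 * \<bar>i\<bar> dvd i" using zdvd_imp_le[of "2 * \<bar>i\<bar>" "\<bar>i\<bar>"] by auto
    moreover have "carrier G \<in> finite_index_normal G"
      using finite_index_normal_kernel[OF is_group is_group trivial_hom] by (simp add: kernel_def image_constant_conv)
    ultimately show ?thesis
      using finite_index_normal_E[of "carrier G" "\<bar>i\<bar>"] \<open>i \<noteq> 0\<close> \<theta>_closed gi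
      by (intro bexI[of _ "{(x, j). x \<in> carrier G \<and> 2 * \<bar>i\<bar> dvd j}"]) auto
  next
    case False
    then obtain L where L: "L \<in> finite_index_normal G" "x \<notin> L"
      using assms gi by (auto simp: residually_finite_group_def)
    \<comment> \<open>the largest \<open>\<theta>\<close>-invariant subgroup of \<open>L\<close>\<close>
    define L' where "L' = L \<inter> {x \<in> carrier G. \<theta> x \<in> L}"
    have "L' \<in> finite_index_normal G"
      unfolding L'_def
      by (intro finite_index_normal_Int finite_index_normal_vimage[OF is_group is_group \<theta>_hom] L(1) is_group)
    moreover have "\<theta> x \<in> L'" if "x \<in> L'" for x
      using that by (simp add: L'_def \<theta>_closed \<theta>_\<theta>)
    ultimately have "{(x, i). x \<in> L' \<and> 2 * 1 dvd i} \<in> finite_index_normal E"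
      by (rule finite_index_normal_E) simp_all
    then show ?thesis using L(2) gi by (intro bexI) (auto simp: L'_def)
  qed
qed

text \<open>
  Congruence modulo \<open>K\<close> of two elements with the same integer coordinate can be tested in \<open>G\<close>. This is
  how finite index conditions on \<open>G\<close> suffice for all finite quotients of the extension.
\<close>

lemma rcos_E:
  assumes K: "K \<in> finite_index_normal E" and xy: "x \<in> carrier G" "y \<in> carrier G"
    and L: "{x \<in> carrier G. (x, 0) \<in> K} #> x = {x \<in> carrier G. (x, 0) \<in> K} #> y"
  shows "K #>\<^bsub>E\<^esub> (x, i) = K #>\<^bsub>E\<^esub> (y, i)"
proof -
  interpret E: group E by (rule group_E)
  have sK: "subgroup K E" using K by (simp add: finite_index_normal_def normal_imp_subgroup)
  have "{x \<in> carrier G. (x, 0) \<in> K} \<in> finite_index_normal G"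
    by (rule finite_index_normal_vimage[OF is_group group_E embed_hom K])
  then have "subgroup {x \<in> carrier G. (x, 0) \<in> K} G"
    by (simp add: finite_index_normal_def normal_imp_subgroup)
  then have "(x \<otimes> inv y, 0) \<in> K" using L rcos_eq_iff xy by blast
  moreover have "(x, i) \<otimes>\<^bsub>E\<^esub> inv\<^bsub>E\<^esub> (y, i) = (x \<otimes> inv y, 0)"
    using xy by (simp add: inv_E mult_E) (simp add: parity_pow_def)
  ultimately show ?thesis using E.rcos_eq_iff[OF sK] xy by (simp add: carrier_E)
qed

end

lemma involutive_group_id: "group G \<Longrightarrow> involutive_group G (\<lambda>x. x)"
  by (simp add: involutive_group_def involutive_group_axioms_def hom_def)

lemma parity_pow_id [simp]: "parity_pow (\<lambda>x. x) i x = x"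
  by (simp add: parity_pow_def)

lemma bi_orderable_direct_extension:
  fixes G (structure)
  assumes G: "group G" and P: "positive_cone G P"
  shows "bi_orderable (involution_extension G (\<lambda>x. x))"
proof -
  interpret involutive_group G "\<lambda>x. x" by (rule involutive_group_id[OF G])
  have P: "P \<subseteq> carrier G" "\<one> \<notin> P" "\<And>x y. x \<in> P \<Longrightarrow> y \<in> P \<Longrightarrow> x \<otimes> y \<in> P"
    "\<And>g x. g \<in> carrier G \<Longrightarrow> x \<in> P \<Longrightarrow> g \<otimes> x \<otimes> inv g \<in> P"
    "\<And>x. x \<in> carrier G \<Longrightarrow> x = \<one> \<or> x \<in> P \<or> inv x \<in> P"
    using P unfolding positive_cone_def by blast+
  have "positive_cone E ({x \<in> carrier E. 0 < snd x} \<union> P \<times> {0})"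
    by (rule positive_cone_extension[OF group_E])
      (use P(1-4) in \<open>auto simp: carrier_E mult_E one_E inv_E dest: P(5)\<close>)
  then show ?thesis by (rule bi_orderable_if_positive_cone[OF group_E])
qed

section \<open>Involutions that are limits of inner automorphisms\<close>

lemma (in group) int_pow_intertwine:
  assumes g: "g \<in> carrier G" and xy: "x \<in> carrier G" "y \<in> carrier G"
    and gx: "g \<otimes> x = y \<otimes> g" and gy: "g \<otimes> y = x \<otimes> g"
  shows "g [^] (i::int) \<otimes> x = (if even i then x else y) \<otimes> g [^] i"
proof -
  have nat: "g [^] n \<otimes> x = (if even n then x else y) \<otimes> g [^] n"
    if "x \<in> carrier G" "y \<in> carrier G" "g \<otimes> x = y \<otimes> g" "g \<otimes> y = x \<otimes> g" for n :: nat and x y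
    using that
  proof (induction n arbitrary: x y)
    case (Suc n)
    have "g [^] Suc n \<otimes> x = g [^] n \<otimes> y \<otimes> g"
      using Suc.prems g by (simp add: m_assoc)
    also have "g [^] n \<otimes> y = (if even n then y else x) \<otimes> g [^] n"
      by (rule Suc.IH) (fact Suc.prems)+
    finally show ?case using Suc.prems g by (simp add: m_assoc)
  qed simp
  show ?thesis
  proof (cases "0 \<le> i")
    case True
    then obtain n where "i = int n" using nonneg_int_cases by blast
    then show ?thesis using nat[OF xy gx gy, of n] unfolding \<open>i = int n\<close> int_pow_int by simp
  next
    case False
    define n where "n = nat (- i)"
    define x' where "x' = (if even n then x else y)"
    have i: "i = - int n" using False by (simp add: n_def)
    have "g [^] n \<otimes> x' = x \<otimes> g [^] n"
      using nat[OF xy gx gy, of n] nat[OF xy(2,1) gy gx, of n] by (simp add: x'_def)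
    moreover have "x' \<in> carrier G" using xy by (simp add: x'_def)
    ultimately have "inv (g [^] n) \<otimes> x = x' \<otimes> inv (g [^] n)"
      using g xy(1) by (metis inv_closed inv_solve_left' inv_solve_right m_assoc m_closed nat_pow_closed)
    then show ?thesis using g unfolding i int_pow_neg_int[OF g] by (simp add: x'_def)
  qed
qed

text \<open>
  In a finite quotient of the target the limit \<open>c\<close> of the sequence \<open>\<gamma>\<close> satisfies \<open>c \<eta>(x) = \<theta>(x) c\<close>. Hence the
  generator of \<open>\<int>\<close>, which acts as \<open>\<eta>\<close> there, acts as \<open>\<theta>\<close> after multiplication by \<open>c\<close>. Stating this for two
  involutions lets the map and its inverse be treated at once.
\<close>

theorem limit_hom_involution_extensions:
  fixes G (structure)
  assumes "involutive_group G \<theta>" "involutive_group G \<eta>"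
    and comm: "\<And>x. x \<in> carrier G \<Longrightarrow> \<theta> (\<eta> x) = \<eta> (\<theta> x)"
    and \<gamma>: "\<And>n. \<gamma> n \<in> carrier G" "\<And>n. \<eta> (\<gamma> n) = \<gamma> n"
    and conv: "\<And>L. L \<in> finite_index_normal G \<Longrightarrow> \<exists>m. \<forall>n\<ge>m. L #> \<gamma> n = L #> \<gamma> m"
    and conj: "\<And>L. L \<in> finite_index_normal G \<Longrightarrow>
      \<exists>m. \<forall>n\<ge>m. \<forall>x\<in>carrier G. L #> (\<gamma> n \<otimes> \<eta> x) = L #> (\<theta> x \<otimes> \<gamma> n)"
  shows "limit_hom (involution_extension G \<theta>) (involution_extension G \<eta>)
    (\<lambda>n (x, i). (x \<otimes> \<gamma> n [^] i, i))"
proof -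
  interpret A: involutive_group G \<theta> by fact
  interpret B: involutive_group G \<eta> by fact
  let ?T = "\<lambda>n (x, i). (x \<otimes> \<gamma> n [^] i, i)"
  have \<eta>pow: "parity_pow \<eta> i (\<gamma> n [^] j) = \<gamma> n [^] j" for n and i j :: int
  proof -
    have "\<eta> (\<gamma> n [^] j) = \<gamma> n [^] j"
    proof -
      interpret h: group_hom G G \<eta>
        using B.\<theta>_hom by (simp add: group_hom_def group_hom_axioms_def)
      show ?thesis using h.hom_int_pow[OF \<gamma>(1)] \<gamma>(2) by simp
    qed
    then show ?thesis by (simp add: parity_pow_def)
  qed
  show ?thesis
    unfolding limit_hom_def
  proof (intro conjI allI ballI)
    show "?T n x \<in> carrier B.E" if "x \<in> carrier A.E" for n x
      using that \<gamma>(1) by (auto simp: A.carrier_E B.carrier_E)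
    fix K assume K: "K \<in> finite_index_normal B.E"
    define L where "L = {x \<in> carrier G. (x, 0) \<in> K}"
    have L: "L \<in> finite_index_normal G"
      unfolding L_def by (rule finite_index_normal_vimage[OF A.is_group B.group_E B.embed_hom K])
    interpret L: normal L G using L by (simp add: finite_index_normal_def)
    interpret Q: group "G Mod L" by (rule L.factorgroup_is_group)
    let ?q = "\<lambda>x. L #> x"
    have qmult: "?q (x \<otimes> y) = ?q x \<otimes>\<^bsub>G Mod L\<^esub> ?q y" if "x \<in> carrier G" "y \<in> carrier G" for x y
      using that by (simp add: L.rcos_sum)
    have qc: "?q x \<in> carrier (G Mod L)" if "x \<in> carrier G" for x
      using that by (auto simp: carrier_FactGroup)
    have qpow: "?q (x [^] i) = ?q x [^]\<^bsub>G Mod L\<^esub> i" if "x \<in> carrier G" for x and i :: int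
      using L.FactGroup_int_pow[OF that] by simp
    have rcos: "K #>\<^bsub>B.E\<^esub> (x, i) = K #>\<^bsub>B.E\<^esub> (y, i)"
      if "x \<in> carrier G" "y \<in> carrier G" "?q x = ?q y" for x y i
      using B.rcos_E[OF K that(1,2)] that(3) unfolding L_def by blast
    obtain m1 where m1: "\<And>n. n \<ge> m1 \<Longrightarrow> ?q (\<gamma> n) = ?q (\<gamma> m1)" using conv[OF L] by blast
    obtain m2 where m2: "\<And>n x. n \<ge> m2 \<Longrightarrow> x \<in> carrier G \<Longrightarrow> ?q (\<gamma> n \<otimes> \<eta> x) = ?q (\<theta> x \<otimes> \<gamma> n)"
      using conj[OF L] by blast
    define m where "m = max m1 m2"
    have T1: "K #>\<^bsub>B.E\<^esub> ?T n g = K #>\<^bsub>B.E\<^esub> ?T m g" if n: "n \<ge> m" and g: "g \<in> carrier A.E" for n g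
    proof -
      obtain x i where gi: "g = (x, i)" "x \<in> carrier G" using g by (cases g) (auto simp: A.carrier_E)
      have "?q (\<gamma> n) = ?q (\<gamma> m)" using m1[of n] m1[of m] n by (simp add: m_def)
      then have "?q (x \<otimes> \<gamma> n [^] i) = ?q (x \<otimes> \<gamma> m [^] i)"
        using gi \<gamma>(1) by (simp only: qmult qpow A.int_pow_closed)
      then show ?thesis using rcos gi \<gamma>(1) by simp
    qed
    \<comment> \<open>Both sides start with \<open>x\<close> and end with a power of \<open>\<gamma> n\<close>; the fact \<open>key\<close> moves \<open>y\<close> past the other power.\<close>
    have T2: "K #>\<^bsub>B.E\<^esub> ?T n (g \<otimes>\<^bsub>A.E\<^esub> h) = K #>\<^bsub>B.E\<^esub> (?T n g \<otimes>\<^bsub>B.E\<^esub> ?T n h)"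
      if n: "n \<ge> m" and g: "g \<in> carrier A.E" and h: "h \<in> carrier A.E" for n g h
    proof -
      obtain x i where gi: "g = (x, i)" "x \<in> carrier G" using g by (cases g) (auto simp: A.carrier_E)
      obtain y j where hj: "h = (y, j)" "y \<in> carrier G" using h by (cases h) (auto simp: A.carrier_E)
      let ?g = "?q (\<gamma> n)"
      have swap: "?g \<otimes>\<^bsub>G Mod L\<^esub> ?q (\<eta> z) = ?q (\<theta> z) \<otimes>\<^bsub>G Mod L\<^esub> ?g" if "z \<in> carrier G" for z
        using m2[of n z] n that \<gamma>(1) by (simp only: qmult A.\<theta>_closed B.\<theta>_closed m_def max.bounded_iff)
      have pow: "?g [^]\<^bsub>G Mod L\<^esub> i \<otimes>\<^bsub>G Mod L\<^esub> ?q z =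
          ?q (if even i then z else \<theta> (\<eta> z)) \<otimes>\<^bsub>G Mod L\<^esub> ?g [^]\<^bsub>G Mod L\<^esub> i"
        if z: "z \<in> carrier G" for z
      proof -
        have 1: "?g \<otimes>\<^bsub>G Mod L\<^esub> ?q z = ?q (\<theta> (\<eta> z)) \<otimes>\<^bsub>G Mod L\<^esub> ?g"
          using swap[of "\<eta> z"] z by (simp only: B.\<theta>_closed B.\<theta>_\<theta>)
        have 2: "?g \<otimes>\<^bsub>G Mod L\<^esub> ?q (\<theta> (\<eta> z)) = ?q z \<otimes>\<^bsub>G Mod L\<^esub> ?g"
          using swap[of "\<theta> z"] z by (simp only: A.\<theta>_closed comm A.\<theta>_\<theta>)
        show ?thesis
          using Q.int_pow_intertwine[OF qc qc qc 1 2, of i] \<gamma>(1) z A.\<theta>_closed B.\<theta>_closed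
          by (simp split: if_split_asm)
      qed
      have "?g [^]\<^bsub>G Mod L\<^esub> i \<otimes>\<^bsub>G Mod L\<^esub> ?q (parity_pow \<eta> i y) =
          ?q (parity_pow \<theta> i y) \<otimes>\<^bsub>G Mod L\<^esub> ?g [^]\<^bsub>G Mod L\<^esub> i"
        using pow[of y] pow[of "\<eta> y"] hj(2) B.\<theta>_closed
        by (cases "even i") (simp_all add: parity_pow_def B.\<theta>_\<theta>)
      then have key: "?q (\<gamma> n [^] i \<otimes> parity_pow \<eta> i y) = ?q (parity_pow \<theta> i y \<otimes> \<gamma> n [^] i)"
        using hj(2) \<gamma>(1) by (simp only: qmult qpow A.int_pow_closed A.parity_pow_simps B.parity_pow_simps)
      have "?q (x \<otimes> parity_pow \<theta> i y \<otimes> \<gamma> n [^] (i + j)) =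
          ?q x \<otimes>\<^bsub>G Mod L\<^esub> ?q (parity_pow \<theta> i y \<otimes> \<gamma> n [^] i) \<otimes>\<^bsub>G Mod L\<^esub> ?q (\<gamma> n [^] j)"
        using gi(2) hj(2) \<gamma>(1) by (simp add: A.int_pow_mult A.m_assoc L.rcos_sum)
      also have "\<dots> = ?q (x \<otimes> \<gamma> n [^] i \<otimes> parity_pow \<eta> i (y \<otimes> \<gamma> n [^] j))"
        unfolding key[symmetric] using gi(2) hj(2) \<gamma>(1)
        by (simp add: A.m_assoc \<eta>pow L.rcos_sum)
      finally show ?thesis
        using gi hj \<gamma>(1) by (simp add: A.mult_E B.mult_E) (rule rcos, simp_all add: \<eta>pow)
    qed
    show "\<exists>m. \<forall>n\<ge>m. (\<forall>x\<in>carrier A.E. K #>\<^bsub>B.E\<^esub> ?T n x = K #>\<^bsub>B.E\<^esub> ?T m x) \<and>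
        (\<forall>x\<in>carrier A.E. \<forall>y\<in>carrier A.E.
          K #>\<^bsub>B.E\<^esub> ?T n (x \<otimes>\<^bsub>A.E\<^esub> y) = K #>\<^bsub>B.E\<^esub> (?T n x \<otimes>\<^bsub>B.E\<^esub> ?T n y))"
      using T1 T2 by blast
  qed
qed

theorem isomorphic_completions_involution_extension:
  fixes G (structure) and \<gamma> :: "nat \<Rightarrow> 'a"
  assumes \<theta>: "involutive_group G \<theta>"
    and \<gamma>: "\<And>n. \<gamma> n \<in> carrier G" "\<And>n. \<theta> (\<gamma> n) = \<gamma> n"
    and conv: "\<And>L. L \<in> finite_index_normal G \<Longrightarrow> \<exists>m. \<forall>n\<ge>m. L #> \<gamma> n = L #> \<gamma> m"
    and conj: "\<And>L. L \<in> finite_index_normal G \<Longrightarrow>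
      \<exists>m. \<forall>n\<ge>m. \<forall>x\<in>carrier G. L #> (\<gamma> n \<otimes> x) = L #> (\<theta> x \<otimes> \<gamma> n)"
  shows "isomorphic_profinite_completions
    (involution_extension G (\<lambda>x. x)) (involution_extension G \<theta>)"
proof -
  interpret B: involutive_group G \<theta> by fact
  interpret A: involutive_group G "\<lambda>x. x" by (rule involutive_group_id[OF B.is_group])
  have inv_conv: "\<exists>m. \<forall>n\<ge>m. L #> inv \<gamma> n = L #> inv \<gamma> m" if L: "L \<in> finite_index_normal G" for L
  proof -
    interpret L: normal L G using L by (simp add: finite_index_normal_def)
    obtain m where "\<And>n. n \<ge> m \<Longrightarrow> L #> \<gamma> n = L #> \<gamma> m" using conv[OF L] by blast
    then show ?thesis using L.rcos_inv[OF \<gamma>(1)] by metis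
  qed
  have inv_conj: "\<exists>m. \<forall>n\<ge>m. \<forall>x\<in>carrier G. L #> (inv \<gamma> n \<otimes> \<theta> x) = L #> (x \<otimes> inv \<gamma> n)"
    if L: "L \<in> finite_index_normal G" for L
  proof -
    interpret L: normal L G using L by (simp add: finite_index_normal_def)
    obtain m where m: "\<And>n x. n \<ge> m \<Longrightarrow> x \<in> carrier G \<Longrightarrow> L #> (\<gamma> n \<otimes> x) = L #> (\<theta> x \<otimes> \<gamma> n)"
      using conj[OF L] by blast
    have "L #> (inv \<gamma> n \<otimes> \<theta> x) = L #> (x \<otimes> inv \<gamma> n)" if "n \<ge> m" "x \<in> carrier G" for n x
    proof -
      have "(L #> inv \<gamma> n) <#> (L #> (\<gamma> n \<otimes> x)) <#> (L #> inv \<gamma> n) =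
          (L #> inv \<gamma> n) <#> (L #> (\<theta> x \<otimes> \<gamma> n)) <#> (L #> inv \<gamma> n)"
        using m[OF that] by simp
      then show ?thesis
        using that \<gamma>(1) B.\<theta>_closed by (simp add: L.rcos_sum B.m_assoc B.mult_inv_cancel)
    qed
    then show ?thesis by blast
  qed
  have \<theta>inv: "\<theta> (inv \<gamma> n) = inv \<gamma> n" for n
  proof -
    interpret h: group_hom G G \<theta>
      using B.\<theta>_hom by (simp add: group_hom_def group_hom_axioms_def)
    show ?thesis using h.hom_inv[OF \<gamma>(1)] \<gamma>(2) by simp
  qed
  have S: "limit_hom B.E A.E (\<lambda>n (x, i). (x \<otimes> \<gamma> n [^] i, i))"
    by (rule limit_hom_involution_extensions[OF B.involutive_group_axioms A.involutive_group_axioms])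
      (use \<gamma> conv conj in auto)
  have T: "limit_hom A.E B.E (\<lambda>n (x, i). (x \<otimes> inv \<gamma> n [^] i, i))"
    by (rule limit_hom_involution_extensions[OF A.involutive_group_axioms B.involutive_group_axioms])
      (use \<gamma> \<theta>inv inv_conv inv_conj in auto)
  show ?thesis
    by (rule isomorphic_profinite_completions_if_limit_homs[OF A.group_E B.group_E T S])
      (auto simp: A.carrier_E B.carrier_E B.m_assoc \<gamma>(1) B.int_pow_inv B.mult_inv_cancel)
qed

section \<open>The rationals that are integral at 3\<close>

text \<open>
  The localisation of the integers at the prime \<open>3\<close>, inside the rationals, and the powers of its
  maximal ideal.
\<close>

definition Z3 :: "rat set"
  where "Z3 = {of_int a / of_int b | a b. \<not> (3::int) dvd b}"

definition Z3_ideal :: "nat \<Rightarrow> rat set"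
  where "Z3_ideal n = (\<lambda>z. 3 ^ n * z) ` Z3"

lemma Z3_divide: "\<not> (3::int) dvd b \<Longrightarrow> of_int a / of_int b \<in> Z3"
  by (auto simp: Z3_def)

lemma Z3_of_int: "of_int a \<in> Z3"
  using Z3_divide[of 1 a] by simp

lemma Z3_0: "0 \<in> Z3" and Z3_1: "1 \<in> Z3"
  using Z3_of_int[of 0] Z3_of_int[of 1] by simp_all

lemma not_3_dvd_mult: "\<not> (3::int) dvd a \<Longrightarrow> \<not> 3 dvd b \<Longrightarrow> \<not> 3 dvd a * b"
  using prime_dvd_mult_iff[of "3::int" a b] by simp

lemma Z3_add:
  assumes "x \<in> Z3" "y \<in> Z3"
  shows "x + y \<in> Z3"
proof -
  obtain a b c d :: int where x: "x = of_int a / of_int b" "\<not> 3 dvd b"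
    and y: "y = of_int c / of_int d" "\<not> 3 dvd d"
    using assms by (auto simp: Z3_def)
  then have "b \<noteq> 0" "d \<noteq> 0" by auto
  then have "x + y = of_int (a * d + c * b) / of_int (b * d)"
    using x y by (simp add: field_simps)
  then show ?thesis using Z3_divide[OF not_3_dvd_mult[OF x(2) y(2)]] by metis
qed

lemma Z3_mult:
  assumes "x \<in> Z3" "y \<in> Z3"
  shows "x * y \<in> Z3"
proof -
  obtain a b c d :: int where x: "x = of_int a / of_int b" "\<not> 3 dvd b"
    and y: "y = of_int c / of_int d" "\<not> 3 dvd d"
    using assms by (auto simp: Z3_def)
  have "x * y = of_int (a * c) / of_int (b * d)" using x y by simp
  then show ?thesis using Z3_divide[OF not_3_dvd_mult[OF x(2) y(2)]] by metis
qed

lemma Z3_uminus: "x \<in> Z3 \<Longrightarrow> - x \<in> Z3"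
  using Z3_mult[OF Z3_of_int[of "-1"]] by simp

lemma Z3_ideal_0: "0 \<in> Z3_ideal n"
  using Z3_0 by (force simp: Z3_ideal_def)

lemma Z3_ideal_add:
  assumes "x \<in> Z3_ideal n" "y \<in> Z3_ideal n"
  shows "x + y \<in> Z3_ideal n"
proof -
  obtain a b where "a \<in> Z3" "x = 3 ^ n * a" "b \<in> Z3" "y = 3 ^ n * b"
    using assms by (auto simp: Z3_ideal_def)
  then have "a + b \<in> Z3" "x + y = 3 ^ n * (a + b)" by (simp_all add: Z3_add distrib_left)
  then show ?thesis by (auto simp: Z3_ideal_def)
qed

lemma Z3_ideal_mult:
  assumes "x \<in> Z3_ideal n" "y \<in> Z3"
  shows "x * y \<in> Z3_ideal n" "y * x \<in> Z3_ideal n"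
proof -
  obtain a where "a \<in> Z3" "x = 3 ^ n * a" using assms by (auto simp: Z3_ideal_def)
  then have "a * y \<in> Z3" "x * y = 3 ^ n * (a * y)" using assms by (simp_all add: Z3_mult)
  then show "x * y \<in> Z3_ideal n" by (auto simp: Z3_ideal_def)
  then show "y * x \<in> Z3_ideal n" by (simp add: mult.commute)
qed

lemma Z3_ideal_uminus: "x \<in> Z3_ideal n \<Longrightarrow> - x \<in> Z3_ideal n"
  using Z3_ideal_mult(2)[OF _ Z3_of_int[of "-1"]] by simp

lemma Z3_ideal_diff: "x \<in> Z3_ideal n \<Longrightarrow> y \<in> Z3_ideal n \<Longrightarrow> x - y \<in> Z3_ideal n"
  using Z3_ideal_add Z3_ideal_uminus by (metis diff_conv_add_uminus)

lemma Z3_ideal_of_int_iff: "of_int r \<in> Z3_ideal n \<longleftrightarrow> 3 ^ n dvd r"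
proof
  assume "of_int r \<in> Z3_ideal n"
  then obtain a b :: int where ab: "(of_int r :: rat) = 3 ^ n * (of_int a / of_int b)" "\<not> 3 dvd b"
    by (auto simp: Z3_ideal_def Z3_def)
  then have "b \<noteq> 0" by auto
  then have "(of_int (r * b) :: rat) = of_int (3 ^ n * a)" using ab by (simp add: field_simps)
  then have "3 ^ n dvd r * b" by (metis dvd_triv_left of_int_eq_iff)
  moreover have "coprime (3 ^ n) b"
    using ab(2) prime_imp_coprime[of "3::int" b] by simp
  ultimately show "3 ^ n dvd r" using coprime_dvd_mult_left_iff by blast
next
  assume "3 ^ n dvd r"
  then obtain s where "r = 3 ^ n * s" by blast
  then show "of_int r \<in> Z3_ideal n" using Z3_of_int[of s] by (auto simp: Z3_ideal_def)
qed

lemma Z3_ideal_antimono: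
  assumes "n \<le> n'"
  shows "Z3_ideal n' \<subseteq> Z3_ideal n"
proof
  fix x assume "x \<in> Z3_ideal n'"
  then obtain z where z: "z \<in> Z3" "x = 3 ^ n' * z" by (auto simp: Z3_ideal_def)
  have "x = 3 ^ n * (3 ^ (n' - n) * z)" using z(2) assms by (simp flip: mult.assoc power_add)
  moreover have "3 ^ (n' - n) * z \<in> Z3" using Z3_mult[OF Z3_of_int[of "3 ^ (n' - n)"] z(1)] by simp
  ultimately show "x \<in> Z3_ideal n" by (auto simp: Z3_ideal_def)
qed

lemma Z3_ideal_separates:
  assumes "x \<in> Z3" "x \<noteq> 0"
  obtains m where "\<And>n. n \<ge> m \<Longrightarrow> x \<notin> Z3_ideal n"
proof -
  obtain a b :: int where x: "x = of_int a / of_int b" "\<not> 3 dvd b" using assms(1) by (auto simp: Z3_def)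
  then have a: "a \<noteq> 0" "b \<noteq> 0" using assms(2) by auto
  have "x \<notin> Z3_ideal (nat \<bar>a\<bar>)"
  proof
    assume "x \<in> Z3_ideal (nat \<bar>a\<bar>)"
    then have "x * of_int b \<in> Z3_ideal (nat \<bar>a\<bar>)" using Z3_ideal_mult(1) Z3_of_int by blast
    then have "(3::int) ^ nat \<bar>a\<bar> dvd a" using x(1) a by (simp add: Z3_ideal_of_int_iff)
    then have "\<bar>(3::int) ^ nat \<bar>a\<bar>\<bar> \<le> \<bar>a\<bar>" by (rule dvd_imp_le_int[OF a(1)])
    moreover have "\<bar>a\<bar> < 3 ^ nat \<bar>a\<bar>"
      using of_nat_less_two_power[of "nat \<bar>a\<bar>", where 'a = int]
        power_mono[of "2::int" 3 "nat \<bar>a\<bar>"] by linarith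
    ultimately show False by linarith
  qed
  then show thesis using Z3_ideal_antimono that by blast
qed

text \<open>
  The canonical representative among \<open>0, \<dots>, 3\<^sup>n - 1\<close> of a residue class modulo \<open>3\<^sup>n\<close>.
\<close>

definition Z3_mod :: "nat \<Rightarrow> rat \<Rightarrow> int"
  where "Z3_mod n x = (SOME r. r \<in> {0..<3 ^ n} \<and> x - of_int r \<in> Z3_ideal n)"

lemma Z3_mod:
  assumes "x \<in> Z3"
  shows "Z3_mod n x \<in> {0..<3 ^ n}" "x - of_int (Z3_mod n x) \<in> Z3_ideal n"
proof -
  obtain a b :: int where x: "x = of_int a / of_int b" "\<not> 3 dvd b" using assms by (auto simp: Z3_def)
  have "coprime b (3 ^ n)"
    using x(2) prime_imp_coprime[of "3::int" b] by (simp add: coprime_commute)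
  then obtain c where c: "[b * c = 1] (mod 3 ^ n)" using cong_solve_coprime_int by blast
  define r where "r = (a * c) mod 3 ^ n"
  have "[b * r = b * (a * c)] (mod 3 ^ n)" unfolding r_def by (simp add: cong_def mod_mult_right_eq)
  also have "b * (a * c) = a * (b * c)" by simp
  also have "[a * (b * c) = a * 1] (mod 3 ^ n)" using c by (rule cong_scalar_left)
  finally have "3 ^ n dvd a - b * r" by (simp add: cong_iff_dvd_diff dvd_diff_commute)
  then have "of_int (a - b * r) \<in> Z3_ideal n" by (simp only: Z3_ideal_of_int_iff)
  then have "of_int (a - b * r) * (of_int 1 / of_int b) \<in> Z3_ideal n"
    using Z3_ideal_mult(1) Z3_divide[OF x(2)] by blast
  moreover have "b \<noteq> 0" using x(2) by auto
  then have "of_int (a - b * r) * (of_int 1 / of_int b) = x - of_int r"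
    using x(1) by (simp add: field_simps)
  ultimately have "x - of_int r \<in> Z3_ideal n" by simp
  then have "\<exists>r. r \<in> {0..<3 ^ n} \<and> x - of_int r \<in> Z3_ideal n" by (auto simp: r_def intro!: exI[of _ r])
  from someI_ex[OF this] show "Z3_mod n x \<in> {0..<3 ^ n}" "x - of_int (Z3_mod n x) \<in> Z3_ideal n"
    by (simp_all add: Z3_mod_def)
qed

lemma Z3_mod_eq_iff:
  assumes "x \<in> Z3" "y \<in> Z3"
  shows "Z3_mod n x = Z3_mod n y \<longleftrightarrow> x - y \<in> Z3_ideal n"
proof
  assume "Z3_mod n x = Z3_mod n y"
  then show "x - y \<in> Z3_ideal n"
    using Z3_ideal_diff[OF Z3_mod(2)[OF assms(1)] Z3_mod(2)[OF assms(2)], of n] by simp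
next
  assume "x - y \<in> Z3_ideal n"
  then have "(x - y) - (x - of_int (Z3_mod n x)) + (y - of_int (Z3_mod n y)) \<in> Z3_ideal n"
    using Z3_mod(2)[OF assms(1), of n] Z3_mod(2)[OF assms(2), of n]
    by (meson Z3_ideal_add Z3_ideal_diff)
  then have "of_int (Z3_mod n x - Z3_mod n y) \<in> Z3_ideal n" by simp
  then have "3 ^ n dvd Z3_mod n x - Z3_mod n y" by (simp only: Z3_ideal_of_int_iff)
  then show "Z3_mod n x = Z3_mod n y"
    using Z3_mod(1)[OF assms(1), of n] Z3_mod(1)[OF assms(2), of n]
    by (simp add: mod_eq_dvd_iff[symmetric])
qed

lemma Z3_mod_of_int:
  assumes "r \<in> {0..<3 ^ n}"
  shows "Z3_mod n (of_int r) = r"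
proof -
  have "of_int (r - Z3_mod n (of_int r)) \<in> Z3_ideal n"
    using Z3_mod(2)[OF Z3_of_int[of r], of n] by simp
  then have "3 ^ n dvd r - Z3_mod n (of_int r)" by (simp only: Z3_ideal_of_int_iff)
  then show ?thesis
    using Z3_mod(1)[OF Z3_of_int[of r], of n] assms by (simp add: mod_eq_dvd_iff[symmetric])
qed

section \<open>Multipliers\<close>

text \<open>
  Quotients of integer polynomials all of whose values are positive and prime to \<open>3\<close>. Positivity is
  needed for the order, and being a polynomial quotient both for comparing germs at infinity
  and for the dependence on \<open>i\<close> modulo \<open>3\<^sup>n\<close> only.
\<close>

definition multipliers :: "(int \<Rightarrow> rat) set"
  where "multipliers = {\<lambda>i. of_int (poly p i) / of_int (poly q i) | p q.
    \<forall>i. 0 < poly p i \<and> 0 < poly q i \<and> \<not> 3 dvd poly p i \<and> \<not> 3 dvd poly q i}"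

lemma multipliersI:
  assumes "\<And>i. 0 < poly p i \<and> 0 < poly q i \<and> \<not> 3 dvd poly p i \<and> \<not> 3 dvd poly q i"
    and "\<And>i. \<phi> i = of_int (poly p i) / of_int (poly q i)"
  shows "\<phi> \<in> multipliers"
  using assms unfolding multipliers_def by blast

lemma multipliersE:
  assumes "\<phi> \<in> multipliers"
  obtains p q :: "int poly" where
    "\<And>i. 0 < poly p i" "\<And>i. 0 < poly q i" "\<And>i. \<not> 3 dvd poly p i" "\<And>i. \<not> 3 dvd poly q i"
    "\<And>i. \<phi> i = of_int (poly p i) / of_int (poly q i)"
  using assms unfolding multipliers_def by auto

lemma multipliers_const:
  assumes "0 < c" "\<not> 3 dvd c"
  shows "(\<lambda>_. of_int c) \<in> multipliers"
  using assms by (intro multipliersI[of "[:c:]" "[:1:]"]) auto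

lemma multipliers_mult:
  assumes "\<phi> \<in> multipliers" "\<psi> \<in> multipliers"
  shows "(\<lambda>i. \<phi> i * \<psi> i) \<in> multipliers"
proof -
  obtain p q where pq: "\<And>i. 0 < poly p i" "\<And>i. 0 < poly q i" "\<And>i. \<not> 3 dvd poly p i"
    "\<And>i. \<not> 3 dvd poly q i" "\<And>i. \<phi> i = of_int (poly p i) / of_int (poly q i)"
    using multipliersE[OF assms(1)] by blast
  obtain r s where rs: "\<And>i. 0 < poly r i" "\<And>i. 0 < poly s i" "\<And>i. \<not> 3 dvd poly r i"
    "\<And>i. \<not> 3 dvd poly s i" "\<And>i. \<psi> i = of_int (poly r i) / of_int (poly s i)"
    using multipliersE[OF assms(2)] by blast
  show ?thesis
    by (rule multipliersI[of "p * r" "q * s"]) (use pq rs not_3_dvd_mult in simp_all)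
qed

lemma multipliers_inverse:
  assumes "\<phi> \<in> multipliers"
  shows "(\<lambda>i. 1 / \<phi> i) \<in> multipliers"
proof -
  obtain p q where pq: "\<And>i. 0 < poly p i" "\<And>i. 0 < poly q i" "\<And>i. \<not> 3 dvd poly p i"
    "\<And>i. \<not> 3 dvd poly q i" "\<And>i. \<phi> i = of_int (poly p i) / of_int (poly q i)"
    using multipliersE[OF assms] by blast
  show ?thesis by (rule multipliersI[of q p]) (use pq in simp_all)
qed

lemma multipliers_shift:
  assumes "\<phi> \<in> multipliers"
  shows "(\<lambda>i. \<phi> (i + k)) \<in> multipliers"
proof -
  obtain p q where pq: "\<And>i. 0 < poly p i" "\<And>i. 0 < poly q i" "\<And>i. \<not> 3 dvd poly p i"
    "\<And>i. \<not> 3 dvd poly q i" "\<And>i. \<phi> i = of_int (poly p i) / of_int (poly q i)"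
    using multipliersE[OF assms] by blast
  show ?thesis
    by (rule multipliersI[of "pcompose p [:k, 1:]" "pcompose q [:k, 1:]"])
      (use pq in \<open>simp_all add: poly_pcompose add.commute\<close>)
qed

lemma multipliers_square: "(\<lambda>i. (3 * of_int i + 1)\<^sup>2) \<in> multipliers"
proof (rule multipliersI[of "[:1, 3:]\<^sup>2" 1])
  fix i :: int
  have 3: "\<not> 3 dvd 1 + i * 3" by presburger
  then have "1 + i * 3 \<noteq> 0" by presburger
  moreover have "poly ([:1, 3:]\<^sup>2) i = (1 + i * 3)\<^sup>2" by (simp add: poly_power)
  ultimately show "0 < poly ([:1, 3:]\<^sup>2) i \<and> 0 < poly 1 i \<and> \<not> 3 dvd poly ([:1, 3:]\<^sup>2) i \<and> \<not> 3 dvd poly 1 i"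
    using not_3_dvd_mult[OF 3 3] by (simp only: zero_less_power2 power2_eq_square[symmetric] poly_1) simp
qed (simp add: power2_eq_square algebra_simps)

lemma multipliers_pos: "\<phi> \<in> multipliers \<Longrightarrow> 0 < \<phi> i"
  by (erule multipliersE) simp

lemma multipliers_Z3: "\<phi> \<in> multipliers \<Longrightarrow> \<phi> i \<in> Z3"
  by (erule multipliersE) (simp add: Z3_divide)

lemma poly_cong_int: "(x - y) dvd (poly p x - poly p (y::int))"
proof (induction p)
  case (pCons a p)
  have "poly (pCons a p) x - poly (pCons a p) y = x * (poly p x - poly p y) + (x - y) * poly p y"
    by (simp add: algebra_simps)
  then show ?case using pCons.IH by (simp add: dvd_add)
qed simp

lemma multipliers_cong:
  assumes "\<phi> \<in> multipliers" "3 ^ n dvd i - j"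
  shows "\<phi> i - \<phi> j \<in> Z3_ideal n"
proof -
  obtain p q where pq: "\<And>i. 0 < poly p i" "\<And>i. 0 < poly q i" "\<And>i. \<not> 3 dvd poly p i"
    "\<And>i. \<not> 3 dvd poly q i" "\<And>i. \<phi> i = of_int (poly p i) / of_int (poly q i)"
    using multipliersE[OF assms(1)] by blast
  have "3 ^ n dvd poly p i - poly p j" "3 ^ n dvd poly q i - poly q j"
    using assms(2) poly_cong_int dvd_trans by blast+
  then have "3 ^ n dvd (poly p i - poly p j) * poly q j - poly p j * (poly q i - poly q j)"
    by (meson dvd_diff dvd_mult dvd_mult2)
  then have "of_int (poly p i * poly q j - poly p j * poly q i) \<in> Z3_ideal n"
    by (simp only: Z3_ideal_of_int_iff) (simp add: algebra_simps)
  then have "of_int (poly p i * poly q j - poly p j * poly q i) *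
      (of_int 1 / of_int (poly q i * poly q j)) \<in> Z3_ideal n"
    using Z3_ideal_mult(1) Z3_divide[OF not_3_dvd_mult[OF pq(4) pq(4)]] by blast
  moreover have "poly q i \<noteq> 0" "poly q j \<noteq> 0" using pq(2)[of i] pq(2)[of j] by auto
  ultimately show ?thesis by (simp add: pq(5) field_simps)
qed

lemma poly_int_eventually_sign:
  fixes p :: "int poly"
  assumes "p \<noteq> 0"
  shows "(\<exists>n. \<forall>i\<ge>n. 0 < poly p i) \<or> (\<exists>n. \<forall>i\<ge>n. poly p i < 0)"
  using assms
proof (induction p)
  case (pCons a p)
  show ?case
  proof (cases "p = 0")
    case True
    then have "a \<noteq> 0" using pCons by auto
    then show ?thesis using True by (cases "0 < a") auto
  next
    case False
    from pCons.IH[OF this] show ?thesis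
    proof (elim disjE exE)
      fix n assume n: "\<forall>i\<ge>n. 0 < poly p i"
      have "0 < poly (pCons a p) i" if i: "i \<ge> max (max n 1) (1 - a)" for i
      proof -
        have "i * 1 \<le> i * poly p i" using n i by (intro mult_left_mono) force+
        then show ?thesis using i unfolding poly_pCons by linarith
      qed
      then show ?thesis by blast
    next
      fix n assume n: "\<forall>i\<ge>n. poly p i < 0"
      have "poly (pCons a p) i < 0" if i: "i \<ge> max (max n 1) (1 + a)" for i
      proof -
        have "i * 1 \<le> i * (- poly p i)" using n i by (intro mult_left_mono) force+
        then show ?thesis using i unfolding poly_pCons by linarith
      qed
      then show ?thesis by blast
    qed
  qed
qed simp

text \<open>
  The germs at infinity are linearly ordered, and a multiplier is determined by its germ: a
  polynomial with infinitely many zeros vanishes. This order is invariant under shifts.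
\<close>

lemma multipliers_trichotomy:
  assumes "\<phi> \<in> multipliers"
  shows "\<phi> = (\<lambda>_. 1) \<or> (\<exists>n. \<forall>i\<ge>n. 1 < \<phi> i) \<or> (\<exists>n. \<forall>i\<ge>n. \<phi> i < 1)"
proof -
  obtain p q where pq: "\<And>i. 0 < poly p i" "\<And>i. 0 < poly q i" "\<And>i. \<not> 3 dvd poly p i"
    "\<And>i. \<not> 3 dvd poly q i" "\<And>i. \<phi> i = of_int (poly p i) / of_int (poly q i)"
    using multipliersE[OF assms] by blast
  have gt: "1 < \<phi> i \<longleftrightarrow> 0 < poly (p - q) i" and lt: "\<phi> i < 1 \<longleftrightarrow> poly (p - q) i < 0" for i
    using pq(2)[of i] by (simp_all add: pq(5))
  show ?thesis
  proof (cases "p - q = 0")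
    case True
    then have "\<phi> i = 1" for i using pq(2)[of i] by (simp add: pq(5))
    then show ?thesis by blast
  next
    case False
    then show ?thesis using poly_int_eventually_sign[OF False] gt lt by simp
  qed
qed

section \<open>The affine group\<close>

type_synonym affine = "(int \<Rightarrow> rat) \<times> (int \<Rightarrow> rat) \<times> int"

text \<open>
  The triple \<open>(m, \<phi>, k)\<close> stands for the affine map \<open>y \<mapsto> m + \<phi> \<cdot> y(\<cdot> - k)\<close> on finitely supported functions,
  and the product is composition.
\<close>

definition affine_group :: "affine monoid"
  where "affine_group =
    \<lparr>carrier = {(m, \<phi>, k). finite {i. m i \<noteq> 0} \<and> range m \<subseteq> Z3 \<and> \<phi> \<in> multipliers},
     monoid.mult = (\<lambda>(m, \<phi>, k) (m', \<phi>', k').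
       (\<lambda>i. m i + \<phi> i * m' (i - k), \<lambda>i. \<phi> i * \<phi>' (i - k), k + k')),
     one = (\<lambda>_. 0, \<lambda>_. 1, 0)\<rparr>"

lemma carrier_affine:
  "(m, \<phi>, k) \<in> carrier affine_group \<longleftrightarrow>
    finite {i. m i \<noteq> 0} \<and> (\<forall>i. m i \<in> Z3) \<and> \<phi> \<in> multipliers"
  by (auto simp: affine_group_def)

lemma mult_affine:
  "(m, \<phi>, k) \<otimes>\<^bsub>affine_group\<^esub> (m', \<phi>', k') =
    (\<lambda>i. m i + \<phi> i * m' (i - k), \<lambda>i. \<phi> i * \<phi>' (i - k), k + k')"
  by (simp add: affine_group_def)

lemma one_affine: "\<one>\<^bsub>affine_group\<^esub> = (\<lambda>_. 0, \<lambda>_. 1, 0)"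
  by (simp add: affine_group_def)

lemma finite_support_shift: "finite {i::int. m i \<noteq> (0::rat)} \<Longrightarrow> finite {i. m (i + k) \<noteq> 0}"
  using finite_vimageI[of "{i. m i \<noteq> 0}" "\<lambda>i. i + k"] by (simp add: inj_def vimage_def)

lemma multipliers_one: "(\<lambda>_. 1) \<in> multipliers"
  using multipliers_const[of 1] by simp

lemma affine_inverse:
  assumes "(m, \<phi>, k) \<in> carrier affine_group"
  shows "(\<lambda>i. - (1 / \<phi> (i + k)) * m (i + k), \<lambda>i. 1 / \<phi> (i + k), - k) \<in> carrier affine_group"
    and "(\<lambda>i. - (1 / \<phi> (i + k)) * m (i + k), \<lambda>i. 1 / \<phi> (i + k), - k)
      \<otimes>\<^bsub>affine_group\<^esub> (m, \<phi>, k) = \<one>\<^bsub>affine_group\<^esub>"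
proof -
  have m: "finite {i. m i \<noteq> 0}" "\<And>i. m i \<in> Z3" and \<phi>: "\<phi> \<in> multipliers"
    using assms by (auto simp: carrier_affine)
  have \<psi>: "(\<lambda>i. 1 / \<phi> (i + k)) \<in> multipliers"
    using multipliers_shift[OF multipliers_inverse[OF \<phi>]] .
  have "finite {i. - (1 / \<phi> (i + k)) * m (i + k) \<noteq> 0}"
    by (rule finite_subset[OF _ finite_support_shift[OF m(1), of k]]) auto
  then show "(\<lambda>i. - (1 / \<phi> (i + k)) * m (i + k), \<lambda>i. 1 / \<phi> (i + k), - k) \<in> carrier affine_group"
    unfolding carrier_affine using \<psi> m(2) multipliers_Z3[OF \<psi>]
    by (intro conjI allI Z3_mult Z3_uminus)
  have "\<phi> i \<noteq> 0" for i using multipliers_pos[OF \<phi>, of i] by simp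
  then show "(\<lambda>i. - (1 / \<phi> (i + k)) * m (i + k), \<lambda>i. 1 / \<phi> (i + k), - k)
      \<otimes>\<^bsub>affine_group\<^esub> (m, \<phi>, k) = \<one>\<^bsub>affine_group\<^esub>"
    by (simp add: mult_affine one_affine)
qed

lemma affine_mult_closed:
  assumes "(m, \<phi>, k) \<in> carrier affine_group" "(m', \<phi>', k') \<in> carrier affine_group"
  shows "(m, \<phi>, k) \<otimes>\<^bsub>affine_group\<^esub> (m', \<phi>', k') \<in> carrier affine_group"
proof -
  have a: "finite {i. m i \<noteq> 0}" "\<And>i. m i \<in> Z3" "\<phi> \<in> multipliers"
    and b: "finite {i. m' i \<noteq> 0}" "\<And>i. m' i \<in> Z3" "\<phi>' \<in> multipliers"
    using assms by (auto simp: carrier_affine)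
  have "finite {i. m i + \<phi> i * m' (i - k) \<noteq> 0}"
    by (rule finite_subset[OF _ finite_UnI[OF a(1) finite_support_shift[OF b(1), of "- k"]]]) auto
  moreover have "(\<lambda>i. \<phi> i * \<phi>' (i - k)) \<in> multipliers"
    using multipliers_mult[OF a(3) multipliers_shift[OF b(3), of "- k"]] by simp
  ultimately show ?thesis
    using a b multipliers_Z3 by (simp add: mult_affine carrier_affine Z3_add Z3_mult)
qed

lemma group_affine: "group affine_group"
proof (rule groupI)
  fix x y assume "x \<in> carrier affine_group" "y \<in> carrier affine_group"
  then show "x \<otimes>\<^bsub>affine_group\<^esub> y \<in> carrier affine_group"
    using affine_mult_closed by (cases x; cases y) blast
next
  show "\<one>\<^bsub>affine_group\<^esub> \<in> carrier affine_group"
    by (simp add: one_affine carrier_affine Z3_0 multipliers_one)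
next
  fix x y z assume "x \<in> carrier affine_group" "y \<in> carrier affine_group" "z \<in> carrier affine_group"
  show "x \<otimes>\<^bsub>affine_group\<^esub> y \<otimes>\<^bsub>affine_group\<^esub> z = x \<otimes>\<^bsub>affine_group\<^esub> (y \<otimes>\<^bsub>affine_group\<^esub> z)"
    by (cases x; cases y; cases z) (simp add: mult_affine algebra_simps)
next
  fix x assume x: "x \<in> carrier affine_group"
  show "\<one>\<^bsub>affine_group\<^esub> \<otimes>\<^bsub>affine_group\<^esub> x = x"
    by (cases x) (simp add: one_affine mult_affine)
  obtain m \<phi> k where e: "x = (m, \<phi>, k)" by (cases x)
  show "\<exists>y\<in>carrier affine_group. y \<otimes>\<^bsub>affine_group\<^esub> x = \<one>\<^bsub>affine_group\<^esub>"
    using affine_inverse[of m \<phi> k] x unfolding e by blast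
qed

interpretation B: group affine_group by (rule group_affine)

lemma inv_affine:
  "(m, \<phi>, k) \<in> carrier affine_group \<Longrightarrow>
    inv\<^bsub>affine_group\<^esub> (m, \<phi>, k) = (\<lambda>i. - (1 / \<phi> (i + k)) * m (i + k), \<lambda>i. 1 / \<phi> (i + k), - k)"
  using B.inv_equality affine_inverse by blast

section \<open>Residual finiteness of the affine group\<close>

definition class_sum :: "nat \<Rightarrow> int \<Rightarrow> (int \<Rightarrow> rat) \<Rightarrow> rat"
  where "class_sum n i m = (\<Sum>j | m j \<noteq> 0 \<and> 3 ^ n dvd j - i. m j)"

lemma class_sum_superset:
  assumes "finite A" "{j. m j \<noteq> 0} \<subseteq> A"
  shows "class_sum n i m = (\<Sum>j\<in>A. if 3 ^ n dvd j - i then m j else 0)"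
proof -
  have "class_sum n i m = (\<Sum>j | m j \<noteq> 0 \<and> 3 ^ n dvd j - i. if 3 ^ n dvd j - i then m j else 0)"
    unfolding class_sum_def by (rule sum.cong) auto
  also have "\<dots> = (\<Sum>j\<in>A. if 3 ^ n dvd j - i then m j else 0)"
    by (rule sum.mono_neutral_left) (use assms in auto)
  finally show ?thesis .
qed

lemma Z3_sum: "(\<And>j. j \<in> A \<Longrightarrow> f j \<in> Z3) \<Longrightarrow> sum f A \<in> Z3"
  by (induction A rule: infinite_finite_induct) (auto simp: Z3_0 Z3_add)

lemma Z3_ideal_sum: "(\<And>j. j \<in> A \<Longrightarrow> f j \<in> Z3_ideal n) \<Longrightarrow> sum f A \<in> Z3_ideal n"
  by (induction A rule: infinite_finite_induct) (auto simp: Z3_ideal_0 Z3_ideal_add)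

lemma class_sum_cong:
  assumes "3 ^ n dvd i - i'"
  shows "class_sum n i m = class_sum n i' m"
proof -
  have "3 ^ n dvd j - i \<longleftrightarrow> 3 ^ n dvd j - i'" for j
    using dvd_add_right_iff[OF assms, of "j - i"] by (simp add: algebra_simps)
  then show ?thesis by (simp add: class_sum_def)
qed

lemma class_sum_affine:
  assumes m: "finite {i. m i \<noteq> 0}" and m': "finite {i. m' i \<noteq> 0}" "\<And>i. m' i \<in> Z3"
    and \<phi>: "\<phi> \<in> multipliers"
  shows "class_sum n i (\<lambda>i. m i + \<phi> i * m' (i - k)) -
    (class_sum n i m + \<phi> i * class_sum n (i - k) m') \<in> Z3_ideal n"
proof -
  let ?c = "\<lambda>j. 3 ^ n dvd j - i"
  define A where "A = {j. m j \<noteq> 0} \<union> {j. m' (j - k) \<noteq> 0}"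
  have A: "finite A" using m finite_support_shift[OF m'(1), of "- k"] by (simp add: A_def)
  have inj: "inj_on (\<lambda>j. j - k) A" by (simp add: inj_on_def)
  have "{j. m' j \<noteq> 0} \<subseteq> (\<lambda>j. j - k) ` A"
  proof
    fix j assume "j \<in> {j. m' j \<noteq> 0}"
    then have "j + k \<in> A" by (simp add: A_def)
    then have "j + k - k \<in> (\<lambda>j. j - k) ` A" by (rule imageI)
    then show "j \<in> (\<lambda>j. j - k) ` A" by simp
  qed
  then have m'_sum: "class_sum n (i - k) m' = (\<Sum>j\<in>A. if ?c j then m' (j - k) else 0)"
    using class_sum_superset[of "(\<lambda>j. j - k) ` A" m' n "i - k"] A
    by (simp add: sum.reindex[OF inj] algebra_simps)
  have m_sum: "class_sum n i m = (\<Sum>j\<in>A. if ?c j then m j else 0)"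
    by (rule class_sum_superset[OF A]) (auto simp: A_def)
  have "class_sum n i (\<lambda>i. m i + \<phi> i * m' (i - k)) =
      (\<Sum>j\<in>A. if ?c j then m j + \<phi> j * m' (j - k) else 0)"
    by (rule class_sum_superset[OF A]) (auto simp: A_def)
  then have "class_sum n i (\<lambda>i. m i + \<phi> i * m' (i - k)) -
      (class_sum n i m + \<phi> i * class_sum n (i - k) m') =
      (\<Sum>j\<in>A. if ?c j then (\<phi> j - \<phi> i) * m' (j - k) else 0)"
    unfolding m_sum m'_sum sum_distrib_left diff_diff_eq[symmetric]
    by (simp only: sum_subtractf[symmetric]) (rule sum.cong, auto simp: algebra_simps)
  also have "\<dots> \<in> Z3_ideal n"
    by (rule Z3_ideal_sum) (simp add: Z3_ideal_0 Z3_ideal_mult(1) multipliers_cong[OF \<phi>] m'(2))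
  finally show ?thesis .
qed

text \<open>
  The triple \<open>(i, u, c)\<close> stands for the affine functional \<open>y \<mapsto> c + u \<cdot> \<Sum> y(j)\<close>, with the sum over all \<open>j\<close> congruent
  to \<open>i\<close> modulo \<open>3\<^sup>n\<close> and values modulo \<open>3\<^sup>n\<close>. The affine group acts by precomposition, hence from the right,
  and permutes these finitely many functionals because multipliers are constant, modulo \<open>3\<^sup>n\<close>, on residue
  classes modulo \<open>3\<^sup>n\<close>.
\<close>

definition affine_action :: "nat \<Rightarrow> int \<times> int \<times> int \<Rightarrow> affine \<Rightarrow> int \<times> int \<times> int"
  where "affine_action n = (\<lambda>(i, u, c) (m, \<phi>, k).
    ((i - k) mod 3 ^ n, Z3_mod n (of_int u * \<phi> i), Z3_mod n (of_int c + of_int u * class_sum n i m)))"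

lemma class_sum_Z3: "(\<And>i. m i \<in> Z3) \<Longrightarrow> class_sum n i m \<in> Z3"
  by (simp add: class_sum_def Z3_sum)

lemma affine_action_mult:
  assumes g: "(m, \<phi>, k) \<in> carrier affine_group" and h: "(m', \<phi>', k') \<in> carrier affine_group"
  shows "affine_action n x ((m, \<phi>, k) \<otimes>\<^bsub>affine_group\<^esub> (m', \<phi>', k')) =
    affine_action n (affine_action n x (m, \<phi>, k)) (m', \<phi>', k')"
proof -
  obtain i u c where x: "x = (i, u, c)" by (cases x)
  have a: "finite {i. m i \<noteq> 0}" "\<And>i. m i \<in> Z3" "\<phi> \<in> multipliers"
    and b: "finite {i. m' i \<noteq> 0}" "\<And>i. m' i \<in> Z3" "\<phi>' \<in> multipliers"
    using g h by (auto simp: carrier_affine)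
  note Z = Z3_of_int Z3_mult Z3_add class_sum_Z3[of m, OF a(2)] class_sum_Z3[of m', OF b(2)]
    multipliers_Z3[OF a(3)] multipliers_Z3[OF b(3)]
  let ?i = "(i - k) mod 3 ^ n"
  define U where "U = Z3_mod n (of_int u * \<phi> i)"
  define C where "C = Z3_mod n (of_int c + of_int u * class_sum n i m)"
  have i: "3 ^ n dvd (i - k) - ?i" by (simp add: dvd_minus_mod)
  have U: "of_int u * \<phi> i - of_int U \<in> Z3_ideal n"
    unfolding U_def by (rule Z3_mod(2)) (intro Z)
  have C: "of_int c + of_int u * class_sum n i m - of_int C \<in> Z3_ideal n"
    unfolding C_def by (rule Z3_mod(2)) (intro Z)
  define e where "e = class_sum n i (\<lambda>i. m i + \<phi> i * m' (i - k)) -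
    (class_sum n i m + \<phi> i * class_sum n (i - k) m')"
  have e: "e \<in> Z3_ideal n" unfolding e_def by (rule class_sum_affine[OF a(1) b(1,2) a(3)])
  have s: "class_sum n ?i m' = class_sum n (i - k) m'" using class_sum_cong[OF i] by simp
  have sZ: "class_sum n i (\<lambda>i. m i + \<phi> i * m' (i - k)) \<in> Z3" by (rule class_sum_Z3) (intro Z a b)
  have 1: "((i - k) mod 3 ^ n - k') mod 3 ^ n = (i - (k + k')) mod 3 ^ n"
    by (simp add: mod_diff_left_eq algebra_simps)
  have 2: "Z3_mod n (of_int u * (\<phi> i * \<phi>' (i - k))) = Z3_mod n (of_int U * \<phi>' ?i)"
  proof (subst Z3_mod_eq_iff)
    have "(of_int u * \<phi> i - of_int U) * \<phi>' (i - k) + of_int U * (\<phi>' (i - k) - \<phi>' ?i) \<in> Z3_ideal n"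
      by (intro Z3_ideal_add Z3_ideal_mult U Z multipliers_cong[OF b(3) i])
    then show "of_int u * (\<phi> i * \<phi>' (i - k)) - of_int U * \<phi>' ?i \<in> Z3_ideal n"
      by (simp add: algebra_simps)
  qed (intro Z)+
  have 3: "Z3_mod n (of_int c + of_int u * class_sum n i (\<lambda>i. m i + \<phi> i * m' (i - k))) =
      Z3_mod n (of_int C + of_int U * class_sum n ?i m')"
  proof (subst Z3_mod_eq_iff)
    have "(of_int c + of_int u * class_sum n i m - of_int C) +
        (of_int u * \<phi> i - of_int U) * class_sum n (i - k) m' + of_int u * e \<in> Z3_ideal n"
      by (intro Z3_ideal_add Z3_ideal_mult U C e Z)
    then show "of_int c + of_int u * class_sum n i (\<lambda>i. m i + \<phi> i * m' (i - k)) -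
        (of_int C + of_int U * class_sum n ?i m') \<in> Z3_ideal n"
      unfolding s by (simp add: e_def algebra_simps)
  qed (intro Z sZ)+
  show ?thesis
    using 1 2 3 by (simp add: affine_action_def x mult_affine U_def C_def)
qed

text \<open>
  The functionals modulo \<open>3\<^sup>n\<close> detect everything as \<open>n\<close> grows: the first coordinate detects the shift, the second
  the multiplier, and the third the translation part, once \<open>3\<^sup>n\<close> exceeds the diameter of its support.
\<close>

lemma residually_finite_affine: "residually_finite_group affine_group"
  unfolding residually_finite_group_def
proof (intro conjI ballI impI group_affine)
  fix g assume g: "g \<in> carrier affine_group" "g \<noteq> \<one>\<^bsub>affine_group\<^esub>"
  obtain m \<phi> k where e: "g = (m, \<phi>, k)" by (cases g)
  have m: "finite {i. m i \<noteq> 0}" "\<And>i. m i \<in> Z3" and \<phi>: "\<phi> \<in> multipliers"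
    using g(1) by (auto simp: e carrier_affine)
  let ?X = "\<lambda>n. {0..<(3::int) ^ n} \<times> {0..<(3::int) ^ n} \<times> {0..<(3::int) ^ n}"
  have K: "{g \<in> carrier affine_group. \<forall>x\<in>?X n. affine_action n x g = x} \<in> finite_index_normal affine_group"
    for n
  proof (rule finite_index_normal_right_action[OF group_affine])
    fix g x assume g: "g \<in> carrier affine_group" and x: "x \<in> ?X n"
    obtain m \<phi> k where e: "g = (m, \<phi>, k)" by (cases g)
    have m: "\<And>i. m i \<in> Z3" and \<phi>: "\<phi> \<in> multipliers" using g by (auto simp: e carrier_affine)
    obtain i u c where "x = (i, u, c)" by (cases x)
    then show "affine_action n x g \<in> ?X n"
      using Z3_mod(1)[of "of_int u * \<phi> i" n] Z3_mod(1)[of "of_int c + of_int u * class_sum n i m" n]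
        multipliers_Z3[OF \<phi>] class_sum_Z3[OF m]
      by (simp add: affine_action_def e Z3_mult Z3_add Z3_of_int)
  next
    fix g h x assume "g \<in> carrier affine_group" "h \<in> carrier affine_group"
    then show "affine_action n x (g \<otimes>\<^bsub>affine_group\<^esub> h) = affine_action n (affine_action n x g) h"
      by (cases g; cases h) (use affine_action_mult in blast)
  next
    fix x assume "x \<in> ?X n"
    then show "affine_action n x \<one>\<^bsub>affine_group\<^esub> = x"
      by (cases x) (simp add: affine_action_def one_affine class_sum_def Z3_mod_of_int)
  qed simp
  obtain n x where "x \<in> ?X n" "affine_action n x g \<noteq> x"
  proof (cases "k = 0")
    case False
    define n where "n = Suc (nat \<bar>k\<bar>)"
    have "\<bar>k\<bar> < 3 ^ n"
      using of_nat_less_two_power[of n, where 'a = int] power_mono[of "2::int" 3 n] by (simp add: n_def)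
    then have "\<not> 3 ^ n dvd k" using False by (meson zdvd_not_zless abs_le_D1 dvd_abs_iff zero_less_abs_iff)
    then have "(0 - k) mod 3 ^ n \<noteq> 0" by (simp add: mod_eq_0_iff_dvd)
    then have "affine_action n (0, 0, 0) g \<noteq> (0, 0, 0)" by (simp add: affine_action_def e)
    then show thesis using that[of "(0, 0, 0)" n] by simp
  next
    case k: True
    show thesis
    proof (cases "\<exists>i. \<phi> i \<noteq> 1")
      case True
      then obtain i where i: "\<phi> i - 1 \<noteq> 0" by auto
      have "\<phi> i - 1 \<in> Z3" using Z3_add[OF multipliers_Z3[OF \<phi>] Z3_of_int[of "-1"]] by simp
      from Z3_ideal_separates[OF this i] obtain n0 where n0: "\<And>n. n \<ge> n0 \<Longrightarrow> \<phi> i - 1 \<notin> Z3_ideal n" by blast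
      define n where "n = Suc n0"
      have one: "1 \<in> {0..<(3::int) ^ n}" using one_less_power[of "3::int" n] by (simp add: n_def)
      have "\<phi> i - \<phi> (i mod 3 ^ n) \<in> Z3_ideal n" by (rule multipliers_cong[OF \<phi>]) (simp add: dvd_minus_mod)
      then have "\<phi> (i mod 3 ^ n) - 1 \<notin> Z3_ideal n"
        using n0[of n] Z3_ideal_add by (fastforce simp: n_def)
      then have "Z3_mod n (\<phi> (i mod 3 ^ n)) \<noteq> 1"
        using Z3_mod(2)[OF multipliers_Z3[OF \<phi>], of "i mod 3 ^ n" n] by auto
      then have "affine_action n (i mod 3 ^ n, 1, 0) g \<noteq> (i mod 3 ^ n, 1, 0)"
        by (simp add: affine_action_def e)
      then show thesis using that[of "(i mod 3 ^ n, 1, 0)" n] one by simp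
    next
      case False
      then have "m \<noteq> (\<lambda>_. 0)" using g(2) k by (auto simp: e one_affine)
      then obtain i where i: "m i \<noteq> 0" by auto
      from Z3_ideal_separates[OF m(2) i] obtain n0 where n0: "\<And>n. n \<ge> n0 \<Longrightarrow> m i \<notin> Z3_ideal n" by blast
      obtain M where M: "\<And>j. m j \<noteq> 0 \<Longrightarrow> \<bar>j - i\<bar> \<le> M"
        using finite_imageI[OF m(1), of "\<lambda>j. \<bar>j - i\<bar>"]
        by (metis (mono_tags, lifting) Max_ge image_eqI mem_Collect_eq)
      define n where "n = Suc (max n0 (nat M))"
      have "M \<le> int n" by (simp add: n_def)
      also have "int n < 2 ^ n" by (rule of_nat_less_two_power)
      also have "(2::int) ^ n \<le> 3 ^ n" by (rule power_mono) simp_all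
      finally have n: "M < 3 ^ n" .
      have one: "1 \<in> {0..<(3::int) ^ n}" using one_less_power[of "3::int" n] by (simp add: n_def)
      have "j = i" if "m j \<noteq> 0" "3 ^ n dvd j - i" for j
        using M[OF that(1)] n that(2) zdvd_not_zless[of "\<bar>j - i\<bar>" "3 ^ n"] by auto
      then have "{j. m j \<noteq> 0 \<and> 3 ^ n dvd j - i} = {i}" using i by auto
      then have "class_sum n i m = m i" by (simp add: class_sum_def)
      then have s: "class_sum n (i mod 3 ^ n) m = m i"
        using class_sum_cong[of n i "i mod 3 ^ n" m] by (simp add: dvd_minus_mod)
      have "Z3_mod n (m i) \<noteq> 0"
        using Z3_mod(2)[OF m(2), of i n] n0[of n] by (auto simp: n_def)
      then have "affine_action n (i mod 3 ^ n, 1, 0) g \<noteq> (i mod 3 ^ n, 1, 0)"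
        by (simp add: affine_action_def e s)
      then show thesis using that[of "(i mod 3 ^ n, 1, 0)" n] one by simp
    qed
  qed
  then show "\<exists>N\<in>finite_index_normal affine_group. g \<notin> N"
    by (intro bexI[OF _ K[of n]]) auto
qed

section \<open>A bi-order on the affine group\<close>

definition leading_positive :: "(int \<Rightarrow> rat) \<Rightarrow> bool"
  where "leading_positive m \<longleftrightarrow> (\<exists>i. 0 < m i \<and> (\<forall>j>i. m j = 0))"

text \<open>
  The positive elements with trivial shift: the germ of the multiplier is compared first, then the
  last nonzero value of the translation part.
\<close>

definition affine_kernel_cone :: "affine set"
  where "affine_kernel_cone = {(m, \<phi>, k). (m, \<phi>, k) \<in> carrier affine_group \<and> k = 0 \<and>
    ((\<exists>n. \<forall>i\<ge>n. 1 < \<phi> i) \<or> \<phi> = (\<lambda>_. 1) \<and> leading_positive m)}"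

lemma leading_positive_add:
  assumes "leading_positive m" "leading_positive m'"
  shows "leading_positive (\<lambda>i. m i + m' i)"
proof -
  obtain i j where i: "0 < m i" "\<And>l. l > i \<Longrightarrow> m l = 0" and j: "0 < m' j" "\<And>l. l > j \<Longrightarrow> m' l = 0"
    using assms by (auto simp: leading_positive_def)
  have "0 < m (max i j) + m' (max i j)"
    using i j by (cases i j rule: linorder_cases) (auto simp: max_def)
  then show ?thesis using i(2) j(2) by (auto simp: leading_positive_def intro!: exI[of _ "max i j"])
qed

lemma leading_positive_scale_shift:
  assumes "leading_positive m" "\<And>i. 0 < \<phi> i"
  shows "leading_positive (\<lambda>i. \<phi> i * m (i - k))"
proof -
  obtain i where "0 < m i" "\<And>l. l > i \<Longrightarrow> m l = 0" using assms by (auto simp: leading_positive_def)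
  then show ?thesis
    using assms(2) by (auto simp: leading_positive_def intro!: exI[of _ "i + k"])
qed

lemma leading_positive_trichotomy:
  assumes "finite {i. m i \<noteq> 0}"
  shows "m = (\<lambda>_. 0) \<or> leading_positive m \<or> leading_positive (\<lambda>i. - m i)"
proof (cases "{i. m i \<noteq> 0} = {}")
  case False
  define t where "t = Max {i. m i \<noteq> 0}"
  have "m t \<noteq> 0" using Max_in[OF assms False] by (simp add: t_def)
  moreover have "m j = 0" if "j > t" for j using Max_ge[OF assms, of j] that by (auto simp: t_def)
  ultimately show ?thesis by (cases "0 < m t") (auto simp: leading_positive_def not_less intro!: exI[of _ t])
qed auto

lemma positive_cone_affine:
  "positive_cone affine_group ({x \<in> carrier affine_group. 0 < snd (snd x)} \<union> affine_kernel_cone)"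
proof (rule positive_cone_extension[OF group_affine])
  fix x y :: affine
  show "snd (snd (x \<otimes>\<^bsub>affine_group\<^esub> y)) = snd (snd x) + snd (snd y)"
    by (cases x; cases y) (simp add: mult_affine)
next
  fix x assume "x \<in> affine_kernel_cone"
  then show "x \<in> carrier affine_group \<and> snd (snd x) = 0 \<and> x \<noteq> \<one>\<^bsub>affine_group\<^esub>"
    by (auto simp: affine_kernel_cone_def one_affine leading_positive_def)
next
  fix x y assume x: "x \<in> affine_kernel_cone" and y: "y \<in> affine_kernel_cone"
  obtain m \<phi> m' \<phi>' where e: "x = (m, \<phi>, 0)" "y = (m', \<phi>', 0)"
    using x y by (auto simp: affine_kernel_cone_def)
  have c: "x \<in> carrier affine_group" "y \<in> carrier affine_group"
    using x y by (auto simp: affine_kernel_cone_def)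
  have a: "(\<exists>n. \<forall>i\<ge>n. 1 < \<phi> i) \<or> \<phi> = (\<lambda>_. 1) \<and> leading_positive m"
    and b: "(\<exists>n. \<forall>i\<ge>n. 1 < \<phi>' i) \<or> \<phi>' = (\<lambda>_. 1) \<and> leading_positive m'"
    using x y by (auto simp: affine_kernel_cone_def e)
  have "(\<exists>n. \<forall>i\<ge>n. 1 < \<phi> i * \<phi>' i) \<or>
      (\<lambda>i. \<phi> i * \<phi>' i) = (\<lambda>_. 1) \<and> leading_positive (\<lambda>i. m i + \<phi> i * m' i)"
    using a b
  proof (elim disjE exE conjE)
    fix n n' assume "\<forall>i\<ge>n. 1 < \<phi> i" "\<forall>i\<ge>n'. 1 < \<phi>' i"
    then have "1 < \<phi> i * \<phi>' i" if "i \<ge> max n n'" for i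
      using that by (intro less_1_mult) simp_all
    then show ?thesis by blast
  qed (auto simp: leading_positive_add)
  then show "x \<otimes>\<^bsub>affine_group\<^esub> y \<in> affine_kernel_cone"
    using B.m_closed[OF c] by (simp add: affine_kernel_cone_def e mult_affine)
next
  fix g x assume g: "g \<in> carrier affine_group" and x: "x \<in> affine_kernel_cone"
  obtain m' \<psi> k where eg: "g = (m', \<psi>, k)" by (cases g)
  obtain m \<phi> where e: "x = (m, \<phi>, 0)" using x by (auto simp: affine_kernel_cone_def)
  have c: "x \<in> carrier affine_group" using x by (auto simp: affine_kernel_cone_def)
  have \<psi>: "0 < \<psi> i" for i using g multipliers_pos by (auto simp: eg carrier_affine)
  then have \<psi>0: "\<psi> i \<noteq> 0" for i by (metis less_irrefl)
  have conj: "g \<otimes>\<^bsub>affine_group\<^esub> x \<otimes>\<^bsub>affine_group\<^esub> inv\<^bsub>affine_group\<^esub> g =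
      (\<lambda>i. m' i + \<psi> i * m (i - k) - \<phi> (i - k) * m' i, \<lambda>i. \<phi> (i - k), 0)"
    using g \<psi>0 unfolding eg e by (simp add: inv_affine mult_affine algebra_simps)
  have "(\<exists>n. \<forall>i\<ge>n. 1 < \<phi> i) \<or> \<phi> = (\<lambda>_. 1) \<and> leading_positive m"
    using x by (simp add: affine_kernel_cone_def e)
  then have "(\<exists>n. \<forall>i\<ge>n. 1 < \<phi> (i - k)) \<or>
      (\<lambda>i. \<phi> (i - k)) = (\<lambda>_. 1) \<and> leading_positive (\<lambda>i. m' i + \<psi> i * m (i - k) - \<phi> (i - k) * m' i)"
  proof (elim disjE exE conjE)
    fix n assume "\<forall>i\<ge>n. 1 < \<phi> i"
    then have "\<forall>i\<ge>n + k. 1 < \<phi> (i - k)" by simp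
    then show ?thesis by blast
  qed (simp add: leading_positive_scale_shift \<psi>)
  then show "g \<otimes>\<^bsub>affine_group\<^esub> x \<otimes>\<^bsub>affine_group\<^esub> inv\<^bsub>affine_group\<^esub> g \<in> affine_kernel_cone"
    using B.m_closed[OF B.m_closed[OF g c] B.inv_closed[OF g]]
    unfolding conj by (simp add: affine_kernel_cone_def)
next
  fix x assume x: "x \<in> carrier affine_group" "snd (snd x) = 0"
  obtain m \<phi> where e: "x = (m, \<phi>, 0)" using x(2) by (cases x) auto
  have \<phi>: "\<phi> \<in> multipliers" and m: "finite {i. m i \<noteq> 0}" using x(1) by (auto simp: e carrier_affine)
  have inv: "inv\<^bsub>affine_group\<^esub> x = (\<lambda>i. - (1 / \<phi> i) * m i, \<lambda>i. 1 / \<phi> i, 0)"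
    using inv_affine[of m \<phi> 0] x(1) by (simp add: e)
  have ic: "inv\<^bsub>affine_group\<^esub> x \<in> carrier affine_group" using x(1) by simp
  consider "\<phi> = (\<lambda>_. 1)" | n where "\<forall>i\<ge>n. 1 < \<phi> i" | n where "\<forall>i\<ge>n. \<phi> i < 1"
    using multipliers_trichotomy[OF \<phi>] by blast
  then show "x = \<one>\<^bsub>affine_group\<^esub> \<or> x \<in> affine_kernel_cone \<or> inv\<^bsub>affine_group\<^esub> x \<in> affine_kernel_cone"
  proof cases
    case 1
    then have "(\<lambda>i. - m i, \<lambda>_. 1, 0) \<in> carrier affine_group" using ic inv by simp
    then show ?thesis
      using leading_positive_trichotomy[OF m] x(1) inv 1
      by (auto simp: affine_kernel_cone_def e one_affine)
  next
    case 2
    then show ?thesis using x(1) by (auto simp: affine_kernel_cone_def e)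
  next
    case 3
    have "1 < 1 / \<phi> i" if "i \<ge> n" for i
      using 3 that multipliers_pos[OF \<phi>, of i] by simp
    then show ?thesis using ic unfolding inv by (auto simp: affine_kernel_cone_def)
  qed
qed

section \<open>The four-generator subgroup\<close>

text \<open>
  The square in \<open>gen_a\<close> keeps the multiplier positive at negative arguments, where \<open>3i + 1\<close> is negative;
  up to sign, the numbers \<open>3i + 1\<close> are all the integers prime to \<open>3\<close>. The four elements generate
  the group \<open>N\<close> of the introduction, \<open>core_group\<close>, and \<open>negate\<close> is its involution.
\<close>

definition gen_v :: affine where "gen_v = (\<lambda>i. if i = 0 then 1 else 0, \<lambda>_. 1, 0)"
definition gen_a :: affine where "gen_a = (\<lambda>_. 0, \<lambda>i. (3 * of_int i + 1)\<^sup>2, 0)"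
definition gen_b :: affine where "gen_b = (\<lambda>_. 0, \<lambda>_. 2, 0)"
definition gen_t :: affine where "gen_t = (\<lambda>_. 0, \<lambda>_. 1, 1)"

definition core_group :: "affine monoid"
  where "core_group = affine_group\<lparr>carrier := generate affine_group {gen_v, gen_a, gen_b, gen_t}\<rparr>"

definition negate :: "affine \<Rightarrow> affine"
  where "negate = (\<lambda>(m, \<phi>, k). (\<lambda>i. - m i, \<phi>, k))"

lemma gens_closed: "{gen_v, gen_a, gen_b, gen_t} \<subseteq> carrier affine_group"
  using multipliers_square multipliers_const[of 2] multipliers_one Z3_0 Z3_1
  by (auto simp: gen_v_def gen_a_def gen_b_def gen_t_def carrier_affine)

lemma subgroup_core: "subgroup (carrier core_group) affine_group"
  unfolding core_group_def using B.generate_is_subgroup[OF gens_closed] by simp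

lemma group_core: "group core_group"
  using B.subgroup_imp_group[OF subgroup_core] by (simp add: core_group_def)

interpretation C: group core_group by (rule group_core)

lemma mult_core: "x \<otimes>\<^bsub>core_group\<^esub> y = x \<otimes>\<^bsub>affine_group\<^esub> y"
  and one_core: "\<one>\<^bsub>core_group\<^esub> = \<one>\<^bsub>affine_group\<^esub>"
  by (simp_all add: core_group_def)

lemma core_closed_affine: "x \<in> carrier core_group \<Longrightarrow> x \<in> carrier affine_group"
  using subgroup.subset[OF subgroup_core] by blast

lemma inv_core: "x \<in> carrier core_group \<Longrightarrow> inv\<^bsub>core_group\<^esub> x = inv\<^bsub>affine_group\<^esub> x"
  using B.m_inv_consistent[OF subgroup_core] by (simp add: core_group_def)

lemma generate_core: "generate core_group {gen_v, gen_a, gen_b, gen_t} = carrier core_group"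
proof -
  let ?S = "{gen_v, gen_a, gen_b, gen_t}"
  have "generate (affine_group\<lparr>carrier := carrier core_group\<rparr>) ?S = generate affine_group ?S"
    by (rule B.generate_consistent[OF _ subgroup_core])
      (use B.generate_incl in \<open>auto simp: core_group_def intro: generate.incl\<close>)
  then show ?thesis by (simp add: core_group_def)
qed

lemma gens_core: "{gen_v, gen_a, gen_b, gen_t} \<subseteq> carrier core_group"
  by (auto simp: core_group_def intro: generate.incl)

lemma finitely_generated_core: "finitely_generated_group core_group"
  unfolding finitely_generated_group_def
  by (intro conjI group_core exI[of _ "{gen_v, gen_a, gen_b, gen_t}"] gens_core generate_core) simp

lemma residually_finite_core: "residually_finite_group core_group"
proof (rule residually_finite_group_inj_hom[OF group_core residually_finite_affine])
  show "(\<lambda>x. x) \<in> hom core_group affine_group"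
    using core_closed_affine by (simp add: hom_def mult_core)
qed simp

lemma positive_cone_core: "\<exists>P. positive_cone core_group P"
  using positive_cone_subgroup[OF group_affine subgroup_core positive_cone_affine]
  by (auto simp: core_group_def)

lemma hom_negate: "negate \<in> hom affine_group affine_group"
proof (rule homI)
  fix x assume "x \<in> carrier affine_group"
  then show "negate x \<in> carrier affine_group"
    by (cases x) (simp add: negate_def carrier_affine Z3_uminus)
next
  fix x y
  show "negate (x \<otimes>\<^bsub>affine_group\<^esub> y) = negate x \<otimes>\<^bsub>affine_group\<^esub> negate y"
    by (cases x; cases y) (simp add: negate_def mult_affine)
qed

lemma negate_gen_v: "negate gen_v = inv\<^bsub>affine_group\<^esub> gen_v"
  using inv_affine[of "fst gen_v" "\<lambda>_. 1" 0] gens_closed by (auto simp: gen_v_def negate_def)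

lemma negate_gens: "negate gen_a = gen_a" "negate gen_b = gen_b" "negate gen_t = gen_t"
  by (simp_all add: gen_a_def gen_b_def gen_t_def negate_def)

lemma involutive_negate: "involutive_group core_group negate"
proof (unfold_locales)
  let ?S = "{gen_v, gen_a, gen_b, gen_t}"
  interpret h: group_hom affine_group affine_group negate
    using hom_negate group_affine by (simp add: group_hom_def group_hom_axioms_def)
  have "negate ` ?S \<subseteq> carrier core_group"
    using gens_core C.inv_closed[of gen_v] by (auto simp: negate_gens negate_gen_v inv_core)
  then have "generate affine_group (negate ` ?S) \<subseteq> carrier core_group"
    by (rule B.generate_subgroup_incl[OF _ subgroup_core])
  then have "negate ` carrier core_group \<subseteq> carrier core_group"
    using h.generate_img[OF gens_closed] by (simp add: core_group_def)
  then show "negate \<in> hom core_group core_group"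
    using core_closed_affine by (auto simp: hom_def mult_core)
  show "negate (negate x) = x" for x by (cases x) (simp add: negate_def)
qed

lemma pow_gen_v: "gen_v [^]\<^bsub>core_group\<^esub> (n::nat) = (\<lambda>i. if i = 0 then of_nat n else 0, \<lambda>_. 1, 0)"
proof (induction n)
  case 0
  show ?case unfolding C.nat_pow_0 one_core one_affine by auto
next
  case (Suc n)
  show ?case unfolding C.nat_pow_Suc Suc.IH mult_core by (auto simp: gen_v_def mult_affine)
qed

lemma pow_gen_b: "gen_b [^]\<^bsub>core_group\<^esub> (n::nat) = (\<lambda>_. 0, \<lambda>_. 2 ^ n, 0)"
proof (induction n)
  case 0
  show ?case unfolding C.nat_pow_0 one_core one_affine by auto
next
  case (Suc n)
  show ?case unfolding C.nat_pow_Suc Suc.IH mult_core by (auto simp: gen_b_def mult_affine)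
qed

lemma shift_core: "(\<lambda>_. 0, \<lambda>_. 1, k) \<in> carrier core_group"
proof -
  have nat: "(\<lambda>_. 0, \<lambda>_. 1, int n) \<in> carrier core_group" for n
  proof (induction n)
    case 0
    then show ?case using C.one_closed by (simp add: one_core one_affine)
  next
    case (Suc n)
    have "(\<lambda>_. 0, \<lambda>_. 1, int n) \<otimes>\<^bsub>core_group\<^esub> gen_t \<in> carrier core_group"
      using Suc gens_core by (intro C.m_closed) auto
    then show ?case by (simp add: mult_core gen_t_def mult_affine add.commute)
  qed
  show ?thesis
  proof (cases "0 \<le> k")
    case True
    then show ?thesis using nat[of "nat k"] by simp
  next
    case False
    then have "(\<lambda>_. 0, \<lambda>_. 1, - k) \<in> carrier core_group" using nat[of "nat (- k)"] by simp
    then have "inv\<^bsub>core_group\<^esub> (\<lambda>_. 0, \<lambda>_. 1, - k) \<in> carrier core_group" by (rule C.inv_closed)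
    then show ?thesis
      using inv_core[OF \<open>(\<lambda>_. 0, \<lambda>_. 1, - k) \<in> carrier core_group\<close>]
        inv_affine[OF core_closed_affine[OF \<open>(\<lambda>_. 0, \<lambda>_. 1, - k) \<in> carrier core_group\<close>]] by simp
  qed
qed

lemma shifted_gen_a_core: "(\<lambda>_. 0, \<lambda>i. (3 * of_int (i - j) + 1)\<^sup>2, 0) \<in> carrier core_group"
proof -
  have "(\<lambda>_. 0, \<lambda>_. 1, j) \<otimes>\<^bsub>core_group\<^esub> gen_a \<otimes>\<^bsub>core_group\<^esub> (\<lambda>_. 0, \<lambda>_. 1, - j) \<in> carrier core_group"
    using shift_core gens_core by (intro C.m_closed) auto
  then show ?thesis by (simp add: mult_core gen_a_def mult_affine)
qed

section \<open>Negation is a limit of conjugations\<close>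

lemma (in group) pow_index_mem:
  assumes "L \<in> finite_index_normal G" "x \<in> carrier G"
  shows "x [^] card (rcosets L) \<in> L"
proof -
  interpret L: normal L G using assms(1) by (simp add: finite_index_normal_def)
  interpret Q: group "G Mod L" by (rule L.factorgroup_is_group)
  have "Coset.order (G Mod L) = card (rcosets L)" by (simp add: Coset.order_def FactGroup_def)
  moreover have "L #> x \<in> carrier (G Mod L)" using assms(2) by (auto simp: carrier_FactGroup)
  ultimately have "L #> (x [^] card (rcosets L)) = L"
    using Q.pow_order_eq_1[of "L #> x"] L.FactGroup_pow[OF assms(2)] by simp
  then show ?thesis using rcos_eq_self_iff[OF L.subgroup_axioms] assms(2) by simp
qed

lemma (in group) finite_index_pos:
  assumes "L \<in> finite_index_normal G"
  shows "0 < card (rcosets L)"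
proof -
  have "L #> \<one> \<in> rcosets L" by (auto simp: RCOSETS_def)
  then show ?thesis using assms card_gt_0_iff by (auto simp: finite_index_normal_def)
qed

lemma pow_mult_mem_subgroup:
  assumes "group G" "subgroup L G" "x \<in> carrier G" "x [^]\<^bsub>G\<^esub> (a::nat) \<in> L"
  shows "x [^]\<^bsub>G\<^esub> (a * b) \<in> L"
proof -
  interpret group G by fact
  have "(x [^]\<^bsub>G\<^esub> a) [^]\<^bsub>G\<^esub> b \<in> L"
  proof (induction b)
    case 0
    show ?case unfolding nat_pow_0 by (rule subgroup.one_closed[OF assms(2)])
  next
    case (Suc b)
    show ?case unfolding nat_pow_Suc by (rule subgroup.m_closed[OF assms(2) Suc.IH assms(4)])
  qed
  then show ?thesis using nat_pow_pow[OF assms(3)] by simp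
qed

lemma nat_eq_pow_3_mult:
  fixes l :: nat
  assumes "0 < l"
  obtains a d where "l = 3 ^ a * d" "\<not> 3 dvd d"
proof (rule multiplicity_decompose'[of l 3])
  show "l \<noteq> 0" using assms by simp
  show "\<not> is_unit (3::nat)" by simp
qed (rule that)

lemma conj_gen_v:
  "(\<lambda>_. 0, \<phi>, 0) \<otimes>\<^bsub>core_group\<^esub> (\<lambda>i. if i = 0 then c else 0, \<lambda>_. 1, 0) =
    (\<lambda>i. if i = 0 then \<phi> 0 * c else 0, \<lambda>_. 1, 0) \<otimes>\<^bsub>core_group\<^esub> (\<lambda>_. 0, \<phi>, 0)"
  by (auto simp: mult_core mult_affine)

text \<open>
  In a finite quotient of order \<open>l = 3\<^sup>n d\<close> with \<open>d\<close> prime to \<open>3\<close>, the power of \<open>v\<close> with exponent \<open>3\<^sup>n\<close> is conjugate to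
  its own \<open>d\<^sup>2\<close>-th power, by a shifted copy of \<open>a\<close> whose multiplier takes the value \<open>d\<^sup>2\<close> at \<open>0\<close>. The exponent of the
  latter is a multiple of \<open>l\<close>, so it is trivial.
\<close>

lemma pow_3_gen_v_mem:
  assumes L: "L \<in> finite_index_normal core_group"
  shows "\<exists>n. gen_v [^]\<^bsub>core_group\<^esub> (3 ^ n :: nat) \<in> L"
proof -
  interpret L: normal L core_group using L by (simp add: finite_index_normal_def)
  have v: "gen_v \<in> carrier core_group" using gens_core by simp
  let ?l = "card (rcosets\<^bsub>core_group\<^esub> L)"
  obtain n d where l: "?l = 3 ^ n * d" and d: "\<not> 3 dvd d"
    using nat_eq_pow_3_mult[OF C.finite_index_pos[OF L]] .
  \<comment> \<open>\<open>1 - 3j\<close> is whichever of \<open>d\<close> and \<open>-d\<close> is \<open>1\<close> modulo \<open>3\<close>.\<close>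
  obtain j :: int where j: "(1 - 3 * j)\<^sup>2 = (int d)\<^sup>2"
  proof (cases "d mod 3 = 1")
    case True
    then have "1 - 3 * ((1 - int d) div 3) = int d" by presburger
    then show thesis using that by metis
  next
    case False
    then have "1 - 3 * ((1 + int d) div 3) = - int d" using d by presburger
    then show thesis using that by (metis power2_minus)
  qed
  let ?A = "(\<lambda>_. 0, \<lambda>i. (3 * of_int (i - j) + 1)\<^sup>2, 0) :: affine"
  let ?w = "gen_v [^]\<^bsub>core_group\<^esub> (3 ^ n :: nat)"
  have A: "?A \<in> carrier core_group" by (rule shifted_gen_a_core)
  have w: "?w \<in> carrier core_group" using v by (rule C.nat_pow_closed)
  have "gen_v [^]\<^bsub>core_group\<^esub> (3 ^ n * d * d) \<in> L"
    using pow_mult_mem_subgroup[OF group_core L.subgroup_axioms v, of ?l d] C.pow_index_mem[OF L v] l by simp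
  moreover have "?A \<otimes>\<^bsub>core_group\<^esub> ?w = gen_v [^]\<^bsub>core_group\<^esub> (3 ^ n * d * d) \<otimes>\<^bsub>core_group\<^esub> ?A"
  proof -
    have "(3 * of_int (0 - j) + 1 :: rat)\<^sup>2 = of_int ((1 - 3 * j)\<^sup>2)" by (simp add: algebra_simps)
    also have "\<dots> = of_nat d * of_nat d" unfolding j by (simp add: power2_eq_square)
    finally have "(3 * of_int (0 - j) + 1)\<^sup>2 * of_nat (3 ^ n) = (of_nat (3 ^ n * d * d) :: rat)"
      by (simp add: mult_ac)
    then show ?thesis unfolding pow_gen_v conj_gen_v by (simp only:)
  qed
  ultimately have "inv\<^bsub>core_group\<^esub> ?A \<otimes>\<^bsub>core_group\<^esub> (?A \<otimes>\<^bsub>core_group\<^esub> ?w) \<in> L"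
    using L.inv_op_closed1[OF A] C.m_assoc[OF C.inv_closed[OF A] _ A] L.subset by auto
  then have "?w \<in> L" using C.mult_inv_cancel(2)[OF A w] by simp
  then show ?thesis ..
qed

text \<open>
  With \<open>x = 2\<^sup>e\<close>, \<open>e = 3\<^sup>k\<close>, the induction step uses \<open>x\<^sup>3 + 1 = (x + 1)((x + 1)\<^sup>2 - 3x)\<close>, whose second factor is divisible
  by \<open>3\<close>.
\<close>

lemma dvd_pow_2_pow_3: "(3::nat) ^ Suc k dvd 2 ^ 3 ^ k + 1"
proof (induction k)
  case (Suc k)
  define x :: int where "x = 2 ^ 3 ^ k"
  have "int (3 ^ Suc k) dvd int (2 ^ 3 ^ k + 1)" using Suc by (simp only: of_nat_dvd_iff)
  then have x: "3 ^ Suc k dvd x + 1" by (simp add: x_def add.commute)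
  then have "3 dvd x + 1" using dvd_trans[of "3::int" "3 ^ Suc k"] by simp
  then have "3 dvd (x + 1) * (x + 1) - 3 * x" by (meson dvd_diff dvd_mult dvd_triv_left)
  then have "3 * 3 ^ Suc k dvd ((x + 1) * (x + 1) - 3 * x) * (x + 1)" using x by (rule mult_dvd_mono)
  also have "((x + 1) * (x + 1) - 3 * x) * (x + 1) = x ^ 3 + 1"
    by (simp add: algebra_simps power3_eq_cube)
  also have "x ^ 3 = 2 ^ 3 ^ Suc k" by (simp add: x_def mult.commute flip: power_mult)
  finally have "int (3 ^ Suc (Suc k)) dvd int (2 ^ 3 ^ Suc k + 1)" by (simp add: add.commute)
  then show ?case by (simp only: of_nat_dvd_iff)
qed simp

text \<open>
  Write \<open>l = 3\<^sup>a d\<close> with \<open>d\<close> prime to \<open>3\<close>. Both powers vanish modulo \<open>3\<^sup>a\<close>, and by Euler's theorem both are \<open>1\<close>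
  modulo \<open>d\<close>. So \<open>3\<close> to the \<open>n!\<close> tends, in the profinite integers, to the idempotent that is \<open>0\<close> at the prime \<open>3\<close> and \<open>1\<close> at
  all others.
\<close>

lemma dvd_pow_3_fact_diff:
  fixes l :: nat
  assumes "0 < l" "l \<le> m" "m \<le> n"
  shows "l dvd 3 ^ fact n - 3 ^ fact m"
proof -
  obtain a d where l: "l = 3 ^ a * d" and d: "\<not> 3 dvd d" using nat_eq_pow_3_mult[OF assms(1)] .
  have d0: "0 < d" using assms(1) l by (cases d) auto
  have le: "(fact m :: nat) \<le> fact n" using assms(3) by (rule fact_mono)
  have "a < 3 ^ a" using less_exp[of a] power_mono[of "2::nat" 3 a] by linarith
  also have "3 ^ a \<le> l" using d0 l by simp
  also have "l \<le> fact m" using assms(2) fact_ge_self[of m] by linarith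
  finally have 1: "(3::nat) ^ a dvd 3 ^ fact m" by (simp add: le_imp_power_dvd)
  have "d \<le> l" using l by simp
  then have "totient d \<le> m" using totient_le[of d] assms(2) by linarith
  moreover have "1 \<le> totient d" using d0 by (simp add: Suc_le_eq)
  ultimately have "totient d dvd fact m" "totient d dvd fact n"
    using assms(3) by (auto intro!: dvd_fact)
  then have "totient d dvd fact n - fact m" by (rule dvd_diff_nat[rotated])
  then obtain c where c: "fact n - fact m = totient d * c" by blast
  have "coprime 3 d" using d prime_imp_coprime[of "3::nat" d] by simp
  then have "[3 ^ totient d = 1] (mod d)" by (rule euler_theorem)
  then have "[(3 ^ totient d) ^ c = 1 ^ c] (mod d)" by (rule cong_pow)
  then have "[3 ^ (fact n - fact m) = 1] (mod d)" by (simp add: c power_mult)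
  then have 2: "d dvd 3 ^ (fact n - fact m) - 1"
    by (simp add: cong_altdef_nat)
  have "(3::nat) ^ fact n - 3 ^ fact m = 3 ^ fact m * (3 ^ (fact n - fact m) - 1)"
    using le by (simp add: diff_mult_distrib2 flip: power_add)
  then show ?thesis using mult_dvd_mono[OF 1 2] l by simp
qed

definition conjugator :: "nat \<Rightarrow> affine"
  where "conjugator n = gen_b [^]\<^bsub>core_group\<^esub> (3 ^ fact n :: nat)"

lemma conjugator_closed: "conjugator n \<in> carrier core_group"
  unfolding conjugator_def using gens_core by (intro C.nat_pow_closed) simp

lemma negate_conjugator: "negate (conjugator n) = conjugator n"
  by (simp add: conjugator_def pow_gen_b negate_def)

lemma conjugator_converges:
  assumes L: "L \<in> finite_index_normal core_group"
  shows "\<exists>m. \<forall>n\<ge>m. L #>\<^bsub>core_group\<^esub> conjugator n = L #>\<^bsub>core_group\<^esub> conjugator m"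
proof (intro exI allI impI)
  interpret L: normal L core_group using L by (simp add: finite_index_normal_def)
  let ?l = "card (rcosets\<^bsub>core_group\<^esub> L)"
  have b: "gen_b \<in> carrier core_group" using gens_core by simp
  fix n assume n: "n \<ge> ?l"
  obtain s where s: "3 ^ fact n - 3 ^ fact ?l = ?l * s"
    using dvd_pow_3_fact_diff[OF C.finite_index_pos[OF L] order.refl n] by blast
  have "(3::nat) ^ fact ?l \<le> 3 ^ fact n" using n by (intro power_increasing fact_mono) auto
  then have "3 ^ fact n = ?l * s + 3 ^ fact ?l" using s by linarith
  then have e: "conjugator n = gen_b [^]\<^bsub>core_group\<^esub> (?l * s) \<otimes>\<^bsub>core_group\<^esub> conjugator ?l"
    unfolding conjugator_def using C.nat_pow_mult[OF b] by simp
  have z: "gen_b [^]\<^bsub>core_group\<^esub> (?l * s) \<in> L"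
    using pow_mult_mem_subgroup[OF group_core L.subgroup_axioms b C.pow_index_mem[OF L b]] .
  then have "gen_b [^]\<^bsub>core_group\<^esub> (?l * s) \<in> carrier core_group" using L.subset by blast
  then have "conjugator n \<otimes>\<^bsub>core_group\<^esub> inv\<^bsub>core_group\<^esub> conjugator ?l = gen_b [^]\<^bsub>core_group\<^esub> (?l * s)"
    unfolding e using conjugator_closed by (simp add: C.m_assoc)
  then show "L #>\<^bsub>core_group\<^esub> conjugator n = L #>\<^bsub>core_group\<^esub> conjugator ?l"
    using C.rcos_eq_iff[OF L.subgroup_axioms conjugator_closed conjugator_closed] z by simp
qed

lemma conjugator_inverts_gen_v:
  assumes L: "L \<in> finite_index_normal core_group"
  shows "\<exists>m. \<forall>n\<ge>m. L #>\<^bsub>core_group\<^esub> (conjugator n \<otimes>\<^bsub>core_group\<^esub> gen_v) =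
    L #>\<^bsub>core_group\<^esub> (inv\<^bsub>core_group\<^esub> gen_v \<otimes>\<^bsub>core_group\<^esub> conjugator n)"
proof -
  interpret L: normal L core_group using L by (simp add: finite_index_normal_def)
  have v: "gen_v \<in> carrier core_group" using gens_core by simp
  obtain m where m: "gen_v [^]\<^bsub>core_group\<^esub> (3 ^ m :: nat) \<in> L" using pow_3_gen_v_mem[OF L] by blast
  have "L #>\<^bsub>core_group\<^esub> (conjugator n \<otimes>\<^bsub>core_group\<^esub> gen_v) =
      L #>\<^bsub>core_group\<^esub> (inv\<^bsub>core_group\<^esub> gen_v \<otimes>\<^bsub>core_group\<^esub> conjugator n)" if n: "n \<ge> m" for n
  proof -
    let ?e = "2 ^ 3 ^ fact n :: nat"
    let ?w = "gen_v [^]\<^bsub>core_group\<^esub> ?e"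
    have "(3::nat) ^ m dvd 3 ^ Suc (fact n)"
      using n fact_ge_self[of n] by (intro le_imp_power_dvd) linarith
    then obtain c where c: "?e + 1 = 3 ^ m * c" using dvd_pow_2_pow_3 dvd_trans by blast
    have "?w \<otimes>\<^bsub>core_group\<^esub> gen_v = gen_v [^]\<^bsub>core_group\<^esub> (?e + 1)"
      by simp
    also have "\<dots> \<in> L"
      unfolding c by (rule pow_mult_mem_subgroup[OF group_core L.subgroup_axioms v m])
    finally have "L #>\<^bsub>core_group\<^esub> ?w = L #>\<^bsub>core_group\<^esub> inv\<^bsub>core_group\<^esub> gen_v"
      using C.rcos_eq_iff[OF L.subgroup_axioms] v by simp
    then have "L #>\<^bsub>core_group\<^esub> (?w \<otimes>\<^bsub>core_group\<^esub> conjugator n) =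
        L #>\<^bsub>core_group\<^esub> (inv\<^bsub>core_group\<^esub> gen_v \<otimes>\<^bsub>core_group\<^esub> conjugator n)"
      using L.rcos_sum[of ?w "conjugator n"] L.rcos_sum[of "inv\<^bsub>core_group\<^esub> gen_v" "conjugator n"]
        v conjugator_closed by simp
    moreover have "conjugator n \<otimes>\<^bsub>core_group\<^esub> gen_v = ?w \<otimes>\<^bsub>core_group\<^esub> conjugator n"
      using conj_gen_v[of "\<lambda>_. 2 ^ 3 ^ fact n" 1]
      unfolding pow_gen_v conjugator_def pow_gen_b by (simp add: gen_v_def cong: if_cong)
    ultimately show ?thesis by simp
  qed
  then show ?thesis by blast
qed

lemma hom_eq_on_generate:
  assumes G: "group G" and H: "group H" and h: "h \<in> hom G H" "k \<in> hom G H" and S: "S \<subseteq> carrier G"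
    and eq: "\<And>x. x \<in> S \<Longrightarrow> h x = k x" and x: "x \<in> generate G S"
  shows "h x = k x"
proof -
  interpret h: group_hom G H h using G H h by (simp add: group_hom_def group_hom_axioms_def)
  interpret k: group_hom G H k using G H h by (simp add: group_hom_def group_hom_axioms_def)
  show ?thesis
    using x
  proof (induction rule: generate.induct)
    case (inv x)
    then have "x \<in> carrier G" using S by blast
    then show ?case using eq[OF inv] by simp
  next
    case (eng x y)
    then have "x \<in> carrier G" "y \<in> carrier G" using h.G.generate_incl[OF S] by auto
    then show ?case using eng.IH by simp
  qed (simp_all add: eq)
qed

text \<open>
  Modulo \<open>L\<close>, conjugation by the conjugator and the involution are two homomorphisms into the quotient, so it
  suffices to compare them on the four generators; three of them commute with powers of \<open>b\<close>.
\<close>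

lemma conjugator_negates:
  assumes L: "L \<in> finite_index_normal core_group"
  shows "\<exists>m. \<forall>n\<ge>m. \<forall>x\<in>carrier core_group. L #>\<^bsub>core_group\<^esub> (conjugator n \<otimes>\<^bsub>core_group\<^esub> x) =
    L #>\<^bsub>core_group\<^esub> (negate x \<otimes>\<^bsub>core_group\<^esub> conjugator n)"
proof -
  interpret L: normal L core_group using L by (simp add: finite_index_normal_def)
  interpret N: involutive_group core_group negate by (rule involutive_negate)
  interpret Q: group "core_group Mod L" by (rule L.factorgroup_is_group)
  let ?q = "\<lambda>x. L #>\<^bsub>core_group\<^esub> x"
  have q: "?q \<in> hom core_group (core_group Mod L)" by (rule L.r_coset_hom_Mod)
  have qc: "?q x \<in> carrier (core_group Mod L)" if "x \<in> carrier core_group" for x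
    using that by (auto simp: carrier_FactGroup)
  have qm: "?q (x \<otimes>\<^bsub>core_group\<^esub> y) = ?q x \<otimes>\<^bsub>core_group Mod L\<^esub> ?q y"
    if "x \<in> carrier core_group" "y \<in> carrier core_group" for x y
    using hom_mult[OF q that] .
  obtain m where m: "\<And>n. n \<ge> m \<Longrightarrow> ?q (conjugator n \<otimes>\<^bsub>core_group\<^esub> gen_v) =
      ?q (inv\<^bsub>core_group\<^esub> gen_v \<otimes>\<^bsub>core_group\<^esub> conjugator n)"
    using conjugator_inverts_gen_v[OF L] by blast
  have "?q (conjugator n \<otimes>\<^bsub>core_group\<^esub> x) = ?q (negate x \<otimes>\<^bsub>core_group\<^esub> conjugator n)"
    if n: "n \<ge> m" and x: "x \<in> carrier core_group" for n x
  proof -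
    let ?g = "?q (conjugator n)"
    have g: "?g \<in> carrier (core_group Mod L)" by (rule qc[OF conjugator_closed])
    let ?h = "\<lambda>x. ?g \<otimes>\<^bsub>core_group Mod L\<^esub> ?q x \<otimes>\<^bsub>core_group Mod L\<^esub> inv\<^bsub>core_group Mod L\<^esub> ?g"
    have conj_iff: "?h x = ?q (negate x) \<longleftrightarrow>
        ?q (conjugator n \<otimes>\<^bsub>core_group\<^esub> x) = ?q (negate x \<otimes>\<^bsub>core_group\<^esub> conjugator n)"
      if x: "x \<in> carrier core_group" for x
    proof -
      have "?h x = ?q (negate x) \<longleftrightarrow>
          ?g \<otimes>\<^bsub>core_group Mod L\<^esub> ?q x = ?q (negate x) \<otimes>\<^bsub>core_group Mod L\<^esub> ?g"
        using Q.inv_solve_right'[OF qc[OF N.\<theta>_closed[OF x]] Q.m_closed[OF g qc[OF x]] g]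
          Q.inv_solve_right[OF qc[OF N.\<theta>_closed[OF x]] Q.m_closed[OF g qc[OF x]] g] by metis
      then show ?thesis unfolding qm[OF conjugator_closed x] qm[OF N.\<theta>_closed[OF x] conjugator_closed] .
    qed
    have "?h x = ?q (negate x)"
    proof (rule hom_eq_on_generate[of core_group "core_group Mod L" ?h "\<lambda>x. ?q (negate x)"])
      show "?h \<in> hom core_group (core_group Mod L)"
      proof (rule homI)
        fix x y assume xy: "x \<in> carrier core_group" "y \<in> carrier core_group"
        show "?h (x \<otimes>\<^bsub>core_group\<^esub> y) = ?h x \<otimes>\<^bsub>core_group Mod L\<^esub> ?h y"
          unfolding qm[OF xy] using qc[OF xy(1)] qc[OF xy(2)] g
          by (simp add: Q.m_assoc Q.mult_inv_cancel del: mult_FactGroup)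
      qed (use g qc in \<open>simp del: mult_FactGroup\<close>)
      show "(\<lambda>x. ?q (negate x)) \<in> hom core_group (core_group Mod L)"
        using hom_compose[OF N.\<theta>_hom q] by (simp add: comp_def)
      show "x \<in> generate core_group {gen_v, gen_a, gen_b, gen_t}" using x generate_core by simp
      fix z assume z: "z \<in> {gen_v, gen_a, gen_b, gen_t}"
      then have zc: "z \<in> carrier core_group" using gens_core by blast
      have "?q (conjugator n \<otimes>\<^bsub>core_group\<^esub> z) = ?q (negate z \<otimes>\<^bsub>core_group\<^esub> conjugator n)"
      proof (cases "z = gen_v")
        case True
        then show ?thesis using m[OF n] negate_gen_v inv_core zc by simp
      next
        case False
        then have "negate z = z" using z negate_gens by auto
        moreover have "conjugator n \<otimes>\<^bsub>core_group\<^esub> z = z \<otimes>\<^bsub>core_group\<^esub> conjugator n"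
        proof -
          have "conjugator n = (\<lambda>_. 0, \<lambda>_. 2 ^ 3 ^ fact n, 0)" by (simp add: conjugator_def pow_gen_b)
          then show ?thesis
            using z False by (auto simp: mult_core gen_a_def gen_b_def gen_t_def mult_affine mult.commute)
        qed
        ultimately show ?thesis by simp
      qed
      then show "?h z = ?q (negate z)" using conj_iff[OF zc] by simp
    qed (use gens_core C.is_group Q.is_group in simp_all)
    then show ?thesis using conj_iff[OF x] by simp
  qed
  then show ?thesis by blast
qed

section \<open>Countable models\<close>

lemma countable_generate:
  assumes "group G" "S \<subseteq> carrier G" "countable S"
  shows "countable (generate G S)"
proof -
  interpret group G by fact
  let ?T = "S \<union> m_inv G ` S"
  let ?e = "\<lambda>ws. foldr (\<lambda>x y. x \<otimes>\<^bsub>G\<^esub> y) ws \<one>\<^bsub>G\<^esub>"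
  have T: "?T \<subseteq> carrier G" using assms(2) by auto
  have closed: "?e ws \<in> carrier G" if "ws \<in> lists ?T" for ws
    using that by (induction ws) (use T in auto)
  have app: "?e (ws @ vs) = ?e ws \<otimes>\<^bsub>G\<^esub> ?e vs" if "ws \<in> lists ?T" "vs \<in> lists ?T" for ws vs
    using that(1)
  proof (induction ws)
    case Nil
    then show ?case using closed[OF that(2)] by simp
  next
    case (Cons w ws)
    then have "w \<in> carrier G" "?e ws \<in> carrier G" using T closed by blast+
    then show ?case using Cons.IH closed[OF that(2)] by (simp add: m_assoc)
  qed
  have "x \<in> ?e ` lists ?T" if "x \<in> generate G S" for x
    using that
  proof (induction rule: generate.induct)
    case one
    show ?case by (rule image_eqI[of _ _ "[]"]) auto
  next
    case (incl h)
    then show ?case using assms(2) by (intro image_eqI[of _ _ "[h]"]) auto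
  next
    case (inv h)
    then show ?case using assms(2) by (intro image_eqI[of _ _ "[inv\<^bsub>G\<^esub> h]"]) auto
  next
    case (eng x y)
    then obtain ws vs where "ws \<in> lists ?T" "vs \<in> lists ?T" "x = ?e ws" "y = ?e vs" by blast
    then show ?case using app[of ws vs] by (intro image_eqI[of _ _ "ws @ vs"]) auto
  qed
  then have "generate G S \<subseteq> ?e ` lists ?T" by blast
  moreover have "countable (?e ` lists ?T)" using assms(3) by (intro countable_image countable_lists) simp
  ultimately show ?thesis by (rule countable_subset)
qed

text \<open>
  Transport of structure along an enumeration of the carrier.
\<close>

lemma countable_group_nat_model:
  fixes G (structure)
  assumes "group G" "countable (carrier G)"
  obtains H :: "nat monoid" and h where "group H" "h \<in> iso G H"
proof -
  interpret group G by fact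
  let ?f = "to_nat_on (carrier G)" and ?g = "inv_into (carrier G) (to_nat_on (carrier G))"
  define H :: "nat monoid" where "H = \<lparr>carrier = ?f ` carrier G,
    monoid.mult = (\<lambda>x y. ?f (?g x \<otimes> ?g y)), one = ?f \<one>\<rparr>"
  have inj: "inj_on ?f (carrier G)" using assms(2) by (rule inj_on_to_nat_on)
  have iso: "?f \<in> iso G H"
    using inj by (simp add: iso_def hom_def bij_betw_def H_def inv_into_f_f)
  have "group (H\<lparr>one := ?f \<one>\<rparr>)" by (rule iso_imp_img_group[OF iso])
  then have "group H" by (simp add: H_def)
  then show thesis using iso that by blast
qed

theorem theorem1p1:
  shows "\<not> profinite_property (bi_orderable :: nat monoid \<Rightarrow> bool) \<and>
    (\<exists>(G\<^sub>1 :: nat monoid) (G\<^sub>2 :: nat monoid).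
      finitely_generated_group G\<^sub>1 \<and> residually_finite_group G\<^sub>1 \<and>
      finitely_generated_group G\<^sub>2 \<and> residually_finite_group G\<^sub>2 \<and>
      isomorphic_profinite_completions G\<^sub>1 G\<^sub>2 \<and>
      bi_orderable G\<^sub>1 \<and> \<not> bi_orderable G\<^sub>2)"
proof -
  interpret S: involutive_group core_group negate by (rule involutive_negate)
  interpret D: involutive_group core_group "\<lambda>x. x" by (rule involutive_group_id[OF group_core])
  have "countable (carrier core_group)"
    using countable_generate[OF group_affine gens_closed] by (simp add: core_group_def)
  then have cD: "countable (carrier D.E)" and cS: "countable (carrier S.E)"
    by (simp_all add: D.carrier_E S.carrier_E)
  obtain G1 :: "nat monoid" and h1 where G1: "group G1" "h1 \<in> iso D.E G1"
    using countable_group_nat_model[OF D.group_E cD] .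
  obtain G2 :: "nat monoid" and h2 where G2: "group G2" "h2 \<in> iso S.E G2"
    using countable_group_nat_model[OF S.group_E cS] .
  have i1: "inv_into (carrier D.E) h1 \<in> iso G1 D.E" using group.iso_set_sym[OF D.group_E G1(2)] .
  have i2: "inv_into (carrier S.E) h2 \<in> iso G2 S.E" using group.iso_set_sym[OF S.group_E G2(2)] .
  have rf1: "residually_finite_group G1"
    using residually_finite_group_inj_hom[OF G1(1) D.residually_finite_E[OF residually_finite_core]] i1
    by (auto simp: iso_def bij_betw_def)
  have rf2: "residually_finite_group G2"
    using residually_finite_group_inj_hom[OF G2(1) S.residually_finite_E[OF residually_finite_core]] i2
    by (auto simp: iso_def bij_betw_def)
  have "isomorphic_profinite_completions D.E S.E"
    by (rule isomorphic_completions_involution_extension[OF involutive_negate,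
          of conjugator, OF conjugator_closed negate_conjugator conjugator_converges conjugator_negates])
  then have pc: "isomorphic_profinite_completions G1 G2"
    using isomorphic_profinite_completions_if_iso[OF G1(1) D.group_E i1]
      isomorphic_profinite_completions_if_iso[OF S.group_E G2]
    by (blast intro: isomorphic_profinite_completions_trans)
  have bo1: "bi_orderable G1"
    using bi_orderable_iso[OF D.group_E G1(2)] positive_cone_core bi_orderable_direct_extension[OF group_core] by blast
  have v: "gen_v \<in> carrier core_group" using gens_core by simp
  have "\<not> bi_orderable S.E"
  proof (rule not_bi_orderable_if_conj_inv[OF S.group_E, of "(gen_v, 0)" "(\<one>\<^bsub>core_group\<^esub>, 1)"])
    show "(gen_v, 0) \<noteq> \<one>\<^bsub>S.E\<^esub>" by (auto simp: S.one_E one_core one_affine gen_v_def fun_eq_iff)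
    show "(\<one>\<^bsub>core_group\<^esub>, 1) \<otimes>\<^bsub>S.E\<^esub> (gen_v, 0) \<otimes>\<^bsub>S.E\<^esub> inv\<^bsub>S.E\<^esub> (\<one>\<^bsub>core_group\<^esub>, 1) = inv\<^bsub>S.E\<^esub> (gen_v, 0)"
      using v S.\<theta>_closed[OF v]
      by (simp add: S.mult_E S.inv_E) (simp add: parity_pow_def negate_gen_v inv_core)
  qed (use v in \<open>simp_all add: S.carrier_E\<close>)
  then have bo2: "\<not> bi_orderable G2" using bi_orderable_iso[OF G2(1) i2] by blast
  have "finitely_generated_group G1" "finitely_generated_group G2"
    using finitely_generated_group_iso[OF D.finitely_generated_E[OF finitely_generated_core] G1]
      finitely_generated_group_iso[OF S.finitely_generated_E[OF finitely_generated_core] G2] by auto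
  then show ?thesis
    using rf1 rf2 pc bo1 bo2 unfolding profinite_property_def by blast
qed

end
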